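(* Let $G$ be one of $GL(n,\mathbb{R})$, $SL(n,\mathbb{R})$, $Sp(n,\mathbb{R})$ or $O(n)$, and let $X$ be a continuous $G$-valued cocycle. Suppose $X$ is $GL(n,\mathbb{C})$-reducible to a cocycle $t\mapsto e^{tB}$ such that no eigenvalue of $B$ has its imaginary part in $\{\pi\langle k,\omega\rangle : k\in\mathbb{Z}^d\}\setminus\{0\}$. Then $X$ is $G$-reducible.
   Context: Let $\mathbb{T}^d=\mathbb{R}^d/\mathbb{Z}^d$. Fix $\omega\in\mathbb{R}^d$ rationally independent, i.e. $\langle k,\omega\rangle\neq 0$ for all $k\in\mathbb{Z}^d\setminus\{0\}$. Let $G$ be a Lie subgroup of $GL(n,\mathbb{C})$ with Lie algebra $\mathcal{G}$. A $G$-valued continuous cocycle is the map $X:\mathbb{R}\times\mathbb{T}^d\to G$, $(t,\theta)\mapsto X^t(\theta)$, solving $\frac{d}{dt}X^t(\theta)=A(\theta+t\omega)X^t(\theta)$, $X^0(\theta)=Id$ for all $\theta$, for some continuous $A:\mathbb{T}^d\to\mathcal{G}$. It satisfies $X^{t+s}(\theta)=X^t(\theta+s\omega)X^s(\theta)$. For a Lie subgroup $G'$ of $GL(n,\mathbb{C})$ with Lie algebra $\mathcal{G}'$, a continuous cocycle $X$ with values in $G'$ is $G'$-reducible to the cocycle $t\mapsto e^{tB}$, $B\in\mathcal{G}'$, if there exists a continuous $Z:\mathbb{T}^d\to G'$ such that $X^t(\theta)=Z(\theta+t\omega)^{-1}e^{tB}Z(\theta)$ for all $t\in\mathbb{R}$,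 $\theta\in\mathbb{T}^d$; it is $G'$-reducible if this holds for some $B\in\mathcal{G}'$. For $n$ even, $Sp(n,\mathbb{R})$ is the group of real $n\times n$ matrices $M$ with $M^*JM=J$, where $M^*$ is the transpose and $J=\begin{pmatrix}0&-I_{n/2}\\ I_{n/2}&0\end{pmatrix}$ (so $n$ is assumed even when $G=Sp(n,\mathbb{R})$). *)

theory Defs
  imports "HOL-Analysis.Analysis"
begin

definition int_lattice :: "(real ^ 'd) set" where
  "int_lattice = {k. \<forall>i. k $ i \<in> \<int>}"

definition rationally_independent :: "real ^ 'd \<Rightarrow> bool" where
  "rationally_independent \<omega> \<longleftrightarrow> (\<forall>k \<in> int_lattice - {0}. k \<bullet> \<omega> \<noteq> 0)"

text \<open>Maps on \<open>\<real>\<^sup>d/\<int>\<^sup>d\<close> are represented by their lifts to \<open>\<real>\<^sup>d\<close>, i.e. by \<open>\<int>\<^sup>d\<close>-periodic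
  functions; a map on the torus is continuous iff its lift is.\<close>

definition torus_map :: "(real ^ 'd \<Rightarrow> 'a) \<Rightarrow> bool" where
  "torus_map f \<longleftrightarrow> (\<forall>\<theta>. \<forall>k \<in> int_lattice. f (\<theta> + k) = f \<theta>)"

text \<open>The type class product, power and \<open>exp\<close> are not usable here: on vectors (hence on
  matrices) the class multiplication is componentwise, the matrix product being \<open>**\<close>.\<close>

primrec matrix_power :: "complex ^ 'n ^ 'n \<Rightarrow> nat \<Rightarrow> complex ^ 'n ^ 'n" where
  "matrix_power A 0 = mat 1"
| "matrix_power A (Suc k) = A ** matrix_power A k"

definition matrix_exp :: "complex ^ 'n ^ 'n \<Rightarrow> complex ^ 'n ^ 'n" where
  "matrix_exp A = (\<Sum>k. (1 / fact k) *\<^sub>R matrix_power A k)"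

definition eigenvalue :: "complex ^ 'n ^ 'n \<Rightarrow> complex \<Rightarrow> bool" where
  "eigenvalue A z \<longleftrightarrow> (\<exists>v. v \<noteq> 0 \<and> A *v v = z *s v)"

text \<open>All groups are subsets of \<open>GL(n,\<complex>)\<close>, real matrices being embedded entrywise.\<close>

definition complex_matrix :: "real ^ 'n ^ 'n \<Rightarrow> complex ^ 'n ^ 'n" where
  "complex_matrix M = (\<chi> i j. complex_of_real (M $ i $ j))"

definition GL_complex :: "(complex ^ 'n ^ 'n) set" where
  "GL_complex = {M. invertible M}"

definition GL_real :: "(complex ^ 'n ^ 'n) set" where
  "GL_real = complex_matrix ` {M. invertible M}"

definition SL_real :: "(complex ^ 'n ^ 'n) set" where
  "SL_real = complex_matrix ` {M. det M = 1}"

definition O_real :: "(complex ^ 'n ^ 'n) set" where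
  "O_real = complex_matrix ` {M. orthogonal_matrix M}"

text \<open>The block structure of \<open>J\<close> refers to the enumeration of the index type \<open>'n\<close> in increasing
  order: \<open>index_pos i \<in> {0, \<dots>, n - 1}\<close> is the position of \<open>i\<close>. The definition of \<open>J\<close> is meaningful
  only for even \<open>n = CARD('n)\<close>.\<close>

definition index_pos :: "'n::{finite,linorder} \<Rightarrow> nat" where
  "index_pos i = card {j. j < i}"

definition symplectic_J :: "real ^ 'n::{finite,linorder} ^ 'n::{finite,linorder}" where
  "symplectic_J = (\<chi> i j.
     if index_pos j = index_pos i + CARD('n) div 2 then - 1
     else if index_pos i = index_pos j + CARD('n) div 2 then 1
     else 0)"

definition Sp_real :: "(complex ^ 'n::{finite,linorder} ^ 'n::{finite,linorder}) set" where
  "Sp_real = complex_matrix ` {M. transpose M ** symplectic_J ** M = symplectic_J}"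

text \<open>For \<open>G\<close> closed in \<open>GL(n,\<complex>)\<close> (as all groups here are), the tangent space at the
  identity consists of the infinitesimal generators of the one-parameter subgroups of \<open>G\<close>.\<close>

definition lie_algebra :: "(complex ^ 'n ^ 'n) set \<Rightarrow> (complex ^ 'n ^ 'n) set" where
  "lie_algebra G = {A. \<forall>t::real. matrix_exp (t *\<^sub>R A) \<in> G}"

text \<open>A cocycle \<open>X\<close> is written \<open>X t \<theta>\<close> for \<open>X\<^sup>t(\<theta>)\<close>. The first two conjuncts express that
  it is a map from \<open>\<real> \<times> \<real>\<^sup>d/\<int>\<^sup>d\<close> to \<open>G\<close>.\<close>

definition continuous_cocycle ::
  "real ^ 'd \<Rightarrow> (complex ^ 'n ^ 'n) set \<Rightarrow> (real \<Rightarrow> real ^ 'd \<Rightarrow> complex ^ 'n ^ 'n) \<Rightarrow> bool" where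
  "continuous_cocycle \<omega> G X \<longleftrightarrow>
     (\<forall>t. torus_map (X t)) \<and>
     (\<forall>t \<theta>. X t \<theta> \<in> G) \<and>
     (\<exists>A. torus_map A \<and> continuous_on UNIV A \<and> (\<forall>\<theta>. A \<theta> \<in> lie_algebra G) \<and>
       (\<forall>\<theta>. X 0 \<theta> = mat 1 \<and>
         (\<forall>t. ((\<lambda>s. X s \<theta>) has_vector_derivative A (\<theta> + t *\<^sub>R \<omega>) ** X t \<theta>) (at t))))"

definition reducible_to ::
  "real ^ 'd \<Rightarrow> (complex ^ 'n ^ 'n) set \<Rightarrow> (real \<Rightarrow> real ^ 'd \<Rightarrow> complex ^ 'n ^ 'n) \<Rightarrow>
    complex ^ 'n ^ 'n \<Rightarrow> bool" where
  "reducible_to \<omega> G X B \<longleftrightarrow>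
     B \<in> lie_algebra G \<and>
     (\<exists>Z. torus_map Z \<and> continuous_on UNIV Z \<and> (\<forall>\<theta>. Z \<theta> \<in> G) \<and>
       (\<forall>t \<theta>. X t \<theta> = matrix_inv (Z (\<theta> + t *\<^sub>R \<omega>)) ** matrix_exp (t *\<^sub>R B) ** Z \<theta>))"

definition reducible ::
  "real ^ 'd \<Rightarrow> (complex ^ 'n ^ 'n) set \<Rightarrow> (real \<Rightarrow> real ^ 'd \<Rightarrow> complex ^ 'n ^ 'n) \<Rightarrow> bool" where
  "reducible \<omega> G X \<longleftrightarrow> (\<exists>B. reducible_to \<omega> G X B)"

end

theory Submission
  imports Defs "HOL-Computational_Algebra.Fundamental_Theorem_Algebra"
begin

text \<open>
  Write \<open>F = {2\<pi>\<langle>k,\<omega>\<rangle> : k \<in> \<int>\<^sup>d}\<close>. The proof first makes \<open>B\<close> nonresonant; the conjugation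
  then takes values in \<open>G\<close> as soon as it is normalised to be 1 at the origin.

  If \<open>P\<close> is the spectral projection of \<open>B\<close> for an eigenvalue \<open>z\<close>, conjugating by the map
  \<open>\<theta> \<mapsto> exp(-2\<pi>i\<langle>k,\<theta>\<rangle>) P + (1 - P)\<close> of the torus replaces \<open>z\<close> by \<open>z - 2\<pi>i\<langle>k,\<omega>\<rangle>\<close>
  (\<open>eigenvalue_shift\<close>). So the imaginary parts of the eigenvalues can be moved to any chosen
  representatives of their classes modulo \<open>F\<close>. By hypothesis, \<open>2 Im z \<in> F\<close> holds for an eigenvalue \<open>z\<close>
  only if \<open>Im z = 0\<close>; hence a class that occurs is either \<open>F\<close> itself, represented by 0, or different
  from its negative, and the representatives can be chosen to be odd (\<open>odd_representatives\<close>). After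
  this change, two eigenvalues with \<open>Im z + Im w \<in> F\<close> satisfy \<open>Im z + Im w = 0\<close>
  (\<open>reducible_to_nonresonant\<close>). Replacing \<open>Z\<close> by \<open>R = Z(0)\<^sup>-\<^sup>1 Z\<close> and \<open>B\<close> by \<open>Z(0)\<^sup>-\<^sup>1 B Z(0)\<close> keeps this
  and gives \<open>R(0) = 1\<close>.

  Every algebraic condition on \<open>X\<close> now passes to \<open>R\<close>. If \<open>X\<close> is real, \<open>W = R\<^sup>* R\<^sup>-\<^sup>1\<close>, with \<open>R\<^sup>*\<close> the
  entrywise conjugate, satisfies \<open>W(\<theta> + t\<omega>) = exp(t B\<^sup>*) W(\<theta>) exp(-tB)\<close>. If \<open>X\<close> preserves the bilinear
  form \<open>K\<close>, the transported form \<open>Q = R\<^sup>-\<^sup>T K R\<^sup>-\<^sup>1\<close> satisfies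
  \<open>Q(\<theta> + t\<omega>) = exp(-t B\<^sup>T) Q(\<theta>) exp(-tB)\<close>. In both cases the nonresonance makes such an intertwiner
  constant (\<open>intertwiner_constant\<close>), and its value at 0 is 1 or \<open>K\<close>; so \<open>R\<close> is real, respectively
  preserves \<open>K\<close> (take \<open>K = J\<close> for the symplectic and \<open>K = 1\<close> for the orthogonal group). If
  \<open>det X = 1\<close>, then \<open>t \<mapsto> det R(t\<omega>)\<close> is a bounded real character of \<open>\<real>\<close>, hence 1, and \<open>det R = 1\<close>
  because the orbit is dense. Finally \<open>exp(tB) = R(t\<omega>) X\<^sup>t(0)\<close> lies in the group as well.

  An intertwiner \<open>M\<close> of \<open>A\<close> and \<open>B\<close> is constant if no difference of an eigenvalue of \<open>A\<close> and one of
  \<open>B\<close> has a nonzero imaginary part in \<open>F\<close>. Peeling off the linear factors of polynomials that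
  annihilate \<open>A\<close> and \<open>B\<close> reduces this to a scalar equation \<open>f' = \<nu> f + c\<close> along the flow on the torus
  (\<open>torus_scalar_ode_constant\<close>). If \<open>\<nu> = 0\<close>, boundedness of \<open>f\<close> gives \<open>c = 0\<close> and density of the orbit
  does the rest. If \<open>\<nu> \<noteq> 0\<close>, a nonconstant solution would give a continuous \<open>g \<noteq> 0\<close> with
  \<open>g(\<theta> + t\<omega>) = exp(t\<nu>) g(\<theta>)\<close>; by density of the orbit \<open>g/g(0)\<close> is a character of the torus, so that
  \<open>\<nu> = 2\<pi>i\<langle>k,\<omega>\<rangle>\<close> for some \<open>k\<close> (\<open>torus_eigenfunction\<close>).
\<close>

section \<open>Matrix algebra\<close>

lemma matrix_add_rdistrib: "(A + B) ** C = A ** C + B ** (C :: 'a::semiring_1 ^ 'n ^ 'm)"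
  by (simp add: matrix_matrix_mult_def vec_eq_iff distrib_right sum.distrib)

lemma matrix_diff_ldistrib: "A ** (B - C) = A ** B - A ** (C :: 'a::ring_1 ^ 'n ^ 'm)"
  by (simp add: matrix_matrix_mult_def vec_eq_iff right_diff_distrib sum_subtractf)

lemma matrix_diff_rdistrib: "(A - B) ** C = A ** C - B ** (C :: 'a::ring_1 ^ 'n ^ 'm)"
  by (simp add: matrix_matrix_mult_def vec_eq_iff left_diff_distrib sum_subtractf)

lemma matrix_minus_left: "(- A) ** C = - (A ** (C :: 'a::ring_1 ^ 'n ^ 'm))"
  by (simp add: matrix_matrix_mult_def vec_eq_iff sum_negf)

lemma matrix_zero_left [simp]: "0 ** C = (0 :: 'a::semiring_1 ^ 'n ^ 'm)"
  by (simp add: matrix_matrix_mult_def vec_eq_iff)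

lemma matrix_zero_right [simp]: "C ** 0 = (0 :: 'a::semiring_1 ^ 'n ^ 'm)"
  by (simp add: matrix_matrix_mult_def vec_eq_iff)

lemma mat_mult_component: "(mat c ** M) $ i $ j = c * M $ i $ j"
  by (simp add: matrix_matrix_mult_def mat_def if_distrib[of "\<lambda>x. x * _"] cong: if_cong)

lemma mat_commute: "M ** mat c = mat c ** (M :: 'a::comm_semiring_1 ^ 'n ^ 'n)"
  by (simp add: vec_eq_iff mat_mult_component)
    (simp add: matrix_matrix_mult_def mat_def if_distrib[of "\<lambda>x. _ * x"] mult.commute cong: if_cong)

lemma mat_mult: "mat a ** mat b = mat (a * b :: 'a::comm_semiring_1)"
  by (simp add: vec_eq_iff mat_mult_component) (simp add: mat_def)

lemma mat_add: "mat (a + b) = mat a + mat (b :: 'a::comm_semiring_1)"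
  by (simp add: vec_eq_iff mat_def)

lemma mat_diff: "mat (a - b) = mat a - mat (b :: 'a::comm_ring_1)"
  by (simp add: vec_eq_iff mat_def)

lemma mat_zero [simp]: "mat 0 = (0 :: 'a::comm_semiring_1 ^ 'n ^ 'n)"
  by (simp add: vec_eq_iff mat_def)

lemma mat_vector_mult: "mat c *v v = c *s (v :: 'a::comm_semiring_1 ^ 'n)"
  by (simp add: vec_eq_iff matrix_vector_mult_def mat_def if_distrib[of "\<lambda>x. x * _"] cong: if_cong)

lemma scaleR_eq_mat: "r *\<^sub>R M = mat (complex_of_real r) ** M"
  by (simp add: vec_eq_iff mat_mult_component) (simp add: scaleR_conv_of_real)

lemmas matrix_distribs = matrix_add_ldistrib matrix_add_rdistrib matrix_diff_ldistrib matrix_diff_rdistrib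

lemma mat_left_commute:
  "A ** (mat c ** M) = mat c ** ((A :: 'a::comm_semiring_1 ^ 'n ^ 'n) ** M)"
  by (simp only: matrix_mul_assoc mat_commute[of A])

lemma invertible_inverse:
  assumes "invertible (A :: 'a::field ^ 'n ^ 'n)"
  shows "matrix_inv A ** A = mat 1" "A ** matrix_inv A = mat 1" "invertible (matrix_inv A)"
proof -
  have *: "A ** matrix_inv A = mat 1 \<and> matrix_inv A ** A = mat 1"
    using assms unfolding invertible_def matrix_inv_def by (rule someI_ex)
  then show "matrix_inv A ** A = mat 1" "A ** matrix_inv A = mat 1" by auto
  show "invertible (matrix_inv A)"
    using * invertible_def by blast
qed

lemma matrix_inv_eqI:
  assumes "A ** B = mat (1::'a::field)"
  shows "matrix_inv A = (B :: 'a::field ^ 'n ^ 'n)"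
proof -
  have "invertible A"
    using assms invertible_right_inverse by blast
  then have "matrix_inv A ** (A ** B) = B"
    by (simp add: matrix_mul_assoc invertible_inverse)
  with assms show ?thesis by simp
qed

section \<open>Polynomials of a matrix\<close>

definition peval :: "complex ^ 'n ^ 'n \<Rightarrow> complex poly \<Rightarrow> complex ^ 'n ^ 'n" where
  "peval A p = fold_coeffs (\<lambda>a M. mat a + A ** M) p 0"

lemma peval_0 [simp]: "peval A 0 = 0"
  by (simp add: peval_def)

lemma peval_pCons [simp]: "peval A (pCons a p) = mat a + A ** peval A p"
  by (cases "p = 0 \<and> a = 0") (auto simp: peval_def)

lemma peval_1 [simp]: "peval A 1 = mat 1"
  by (simp add: one_pCons)

lemma peval_add: "peval A (p + q) = peval A p + peval A q"
  by (induction p q rule: poly_induct2) (simp_all add: mat_add matrix_distribs)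

lemma peval_sum: "peval A (\<Sum>k\<in>S. f k) = (\<Sum>k\<in>S. peval A (f k))"
  by (induction S rule: infinite_finite_induct) (simp_all add: peval_add)

lemma peval_smult: "peval A (smult c p) = mat c ** peval A p"
  by (induction p) (simp_all add: matrix_distribs mat_mult mat_left_commute[of A])

lemma peval_mult: "peval A (p * q) = peval A p ** peval A q"
  by (induction p) (simp_all add: peval_add peval_smult matrix_distribs matrix_mul_assoc)

lemma peval_commute: "peval A p ** peval A q = peval A q ** peval A p"
  by (metis mult.commute peval_mult)

lemma peval_linear: "peval A [:- z, 1:] = A - mat z"
  by (simp add: vec_eq_iff) (simp add: mat_def)

lemma peval_eigenvector:
  assumes "A *v v = z *s v"
  shows "peval A p *v v = poly p z *s v"
proof (induction p)
  case (pCons a p)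
  have "A *v (poly p z *s v) = poly p z *s (A *v v)"
    by (simp add: vec.scale)
  then show ?case
    using assms pCons
    by (simp add: matrix_vector_mult_add_rdistrib mat_vector_mult vec.scale_left_distrib
        flip: matrix_vector_mul_assoc)
qed simp

lemma peval_monom: "peval A (monom c k) = mat c ** matrix_power A k"
proof (induction k)
  case (Suc k)
  then show ?case
    by (simp add: monom_Suc mat_left_commute[of A])
qed (simp add: monom_0)

text \<open>The powers of \<open>A\<close> are linearly dependent already over \<open>\<real>\<close>, the matrices being a
  finite-dimensional real vector space.\<close>

lemma annihilating_poly_exists:
  fixes A :: "complex ^ 'n ^ 'n"
  shows "\<exists>p. p \<noteq> 0 \<and> peval A p = 0"
proof (cases "inj (matrix_power A)")
  case False
  then obtain k l where kl: "k \<noteq> l" "matrix_power A k = matrix_power A l"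
    by (auto simp: inj_def)
  have "coeff (monom 1 k + monom (-1) l) k = (1::complex)"
    using kl by simp
  then have "monom 1 k + monom (-1) l \<noteq> (0::complex poly)"
    by (metis coeff_0 zero_neq_one)
  moreover have "peval A (monom 1 k + monom (-1) l) = 0"
  proof -
    have "mat (-1) ** matrix_power A l = - matrix_power A l"
      by (simp add: vec_eq_iff mat_mult_component)
    then show ?thesis
      using kl by (simp add: peval_add peval_monom)
  qed
  ultimately show ?thesis by blast
next
  case True
  let ?N = "Suc (DIM(complex ^ 'n ^ 'n))"
  have "card (matrix_power A ` {..<?N}) = ?N"
    using True by (simp add: card_image inj_on_subset)
  then have "dependent (matrix_power A ` {..<?N})"
    by (intro dependent_biggerset) auto
  then obtain u where u: "\<exists>v \<in> matrix_power A ` {..<?N}. u v \<noteq> 0"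
      "(\<Sum>v \<in> matrix_power A ` {..<?N}. u v *\<^sub>R v) = 0"
    by (subst (asm) dependent_finite) auto
  define c where "c = (\<lambda>k. complex_of_real (u (matrix_power A k)))"
  define p where "p = (\<Sum>k<?N. monom (c k) k)"
  have coeff: "coeff p k = c k" if "k < ?N" for k
    using that by (simp add: p_def coeff_sum if_distrib cong: if_cong)
  obtain k where "k < ?N" "c k \<noteq> 0"
    using u(1) by (auto simp: c_def)
  with coeff[of k] have "p \<noteq> 0" by auto
  moreover have "peval A p = (\<Sum>k<?N. peval A (monom (c k) k))"
    unfolding p_def by (rule peval_sum)
  moreover have "\<dots> = (\<Sum>k<?N. u (matrix_power A k) *\<^sub>R matrix_power A k)"
    by (intro sum.cong refl) (simp only: peval_monom c_def scaleR_eq_mat)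
  moreover have "\<dots> = 0"
    using u(2) True by (simp add: sum.reindex inj_on_subset)
  ultimately show ?thesis by auto
qed

text \<open>An annihilating polynomial of least degree is the minimal polynomial: if \<open>(x - z) q\<close> is
  minimal, then \<open>q(A) \<noteq> 0\<close>, and every nonzero vector in the range of \<open>q(A)\<close> is an eigenvector for \<open>z\<close>.\<close>

lemma annihilating_poly_eigenvalues:
  obtains p where "p \<noteq> 0" "peval A p = 0" "\<forall>z. poly p z = 0 \<longleftrightarrow> eigenvalue A z"
proof -
  obtain p where p: "p \<noteq> 0" "peval A p = 0"
    and min: "\<And>q. q \<noteq> 0 \<and> peval A q = 0 \<Longrightarrow> degree p \<le> degree q"
    using ex_has_least_nat[of "\<lambda>p. p \<noteq> 0 \<and> peval A p = 0" _ degree] annihilating_poly_exists[of A]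
    by blast
  have "eigenvalue A z" if root: "poly p z = 0" for z
  proof -
    obtain q where q: "p = [:- z, 1:] * q"
      using root unfolding poly_eq_0_iff_dvd by (rule dvdE)
    have "q \<noteq> 0" using p q by auto
    then have "degree q < degree p"
      using q by (simp add: degree_mult_eq del: mult_pCons_left)
    with min[of q] \<open>q \<noteq> 0\<close> have "peval A q \<noteq> 0" by fastforce
    then obtain v where v: "peval A q *v v \<noteq> 0"
      using matrix_eq[of "peval A q" 0] by auto
    have "(A - mat z) *v (peval A q *v v) = 0"
      using p(2) unfolding q peval_mult peval_linear by (simp add: matrix_vector_mul_assoc)
    then have "A *v (peval A q *v v) = z *s (peval A q *v v)"
      by (simp add: matrix_vector_mult_diff_rdistrib mat_vector_mult)
    with v show ?thesis unfolding eigenvalue_def by blast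
  qed
  moreover have "poly p z = 0" if "eigenvalue A z" for z
    using that peval_eigenvector[of A _ z p] p(2) unfolding eigenvalue_def by auto
  ultimately show thesis using that p by blast
qed

lemma finite_eigenvalues:
  fixes A :: "complex ^ 'n ^ 'n"
  shows "finite {z. eigenvalue A z}"
proof -
  obtain p where p: "p \<noteq> 0" "peval A p = 0" "\<forall>z. poly p z = 0 \<longleftrightarrow> eigenvalue A z"
    by (rule annihilating_poly_eigenvalues[of A])
  then have "{z. eigenvalue A z} = {z. poly p z = 0}" by auto
  then show ?thesis using poly_roots_finite[OF p(1)] by simp
qed

lemma eigenvalue_iff_not_invertible: "eigenvalue A z \<longleftrightarrow> \<not> invertible (A - mat z)"
  unfolding invertible_left_inverse matrix_left_invertible_ker eigenvalue_def
  by (auto simp: matrix_vector_mult_diff_rdistrib mat_vector_mult)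

text \<open>Modulo \<open>x - z\<close> the polynomial \<open>q\<close> is the nonzero constant \<open>q(z)\<close>, hence invertible; multiplying
  \<open>m\<close> copies of the resulting Bezout relation gives the relation for the power.\<close>

lemma bezout_linear_power:
  assumes "\<not> [:- z, 1:] dvd (q :: complex poly)"
  obtains u v where "u * [:- z, 1:] ^ m + v * q = 1"
proof -
  define x where "x = [:- z, 1:]"
  have "poly q z \<noteq> 0"
    using assms unfolding poly_eq_0_iff_dvd .
  obtain s where "q - [:poly q z:] = x * s"
    using poly_eq_0_iff_dvd[of "q - [:poly q z:]" z] by (auto simp: x_def)
  then have "q - x * s = [:poly q z:]"
    by (simp add: algebra_simps)
  moreover define d where "d = [:inverse (poly q z):]"
  ultimately have one: "d * (q - x * s) = 1"
    using \<open>poly q z \<noteq> 0\<close> by (simp add: one_pCons)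
  have "\<exists>u v. u * x ^ m + v * q = 1"
  proof (induction m)
    case 0
    then show ?case by (intro exI[of _ 1] exI[of _ 0]) simp
  next
    case (Suc m)
    then obtain u v where uv: "u * x ^ m + v * q = 1"
      by blast
    have "(- d * s * u) * x ^ Suc m + (v + d * u * x ^ m) * q = d * (q - x * s) * (u * x ^ m) + v * q"
      by (simp add: algebra_simps)
    also have "\<dots> = 1"
      by (simp only: one uv mult_1)
    finally show ?case by blast
  qed
  with that show thesis unfolding x_def by blast
qed

text \<open>The projection on the generalised eigenspace of \<open>z\<close>: an annihilating polynomial is \<open>(x - z)\<^sup>m q\<close> with
  coprime factors, and a Bezout relation \<open>u (x - z)\<^sup>m + v q = 1\<close> gives \<open>P = (v q)(A)\<close>. The last property
  says that \<open>z\<close> is no eigenvalue of \<open>A\<close> on the complementary invariant subspace.\<close>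

lemma spectral_projection:
  assumes "eigenvalue A z"
  obtains P m where "P ** P = P" "A ** P = P ** A" "peval A ([:- z, 1:] ^ m) ** P = 0"
    "\<forall>v. P *v v = 0 \<longrightarrow> A *v v = z *s v \<longrightarrow> v = 0"
proof -
  obtain p where p: "p \<noteq> 0" "peval A p = 0" "\<forall>z. poly p z = 0 \<longleftrightarrow> eigenvalue A z"
    by (rule annihilating_poly_eigenvalues[of A])
  define m where "m = order z p"
  have "m \<noteq> 0"
    using p assms by (auto simp: m_def order_root)
  obtain q where q: "p = [:- z, 1:] ^ m * q" and ndvd: "\<not> [:- z, 1:] dvd q"
    unfolding m_def using order_decomp[OF p(1), of z] by blast
  obtain u v where uv: "u * [:- z, 1:] ^ m + v * q = 1"
    by (rule bezout_linear_power[OF ndvd])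
  let ?N = "peval A [:- z, 1:]"
  define P where "P = peval A (v * q)"
  have compl: "P + peval A (u * [:- z, 1:] ^ m) = mat 1"
    unfolding P_def using uv by (metis add.commute peval_1 peval_add)
  have zero: "peval A ([:- z, 1:] ^ m * r * q) = 0" for r
  proof -
    have "peval A (r * p) = 0"
      by (simp only: peval_mult p(2) matrix_zero_right)
    then show ?thesis
      by (simp add: q mult.left_commute mult.assoc del: mult_pCons_left mult_pCons_right)
  qed
  show thesis
  proof (rule that[of P m])
    have "P ** peval A (u * [:- z, 1:] ^ m) = peval A ([:- z, 1:] ^ m * (u * v) * q)"
      unfolding P_def peval_mult[symmetric]
      by (simp only: mult.assoc mult.left_commute mult.commute)
    then have "P ** (P + peval A (u * [:- z, 1:] ^ m)) = P ** P"
      by (simp only: matrix_add_ldistrib zero add_0_right)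
    then show "P ** P = P"
      by (simp only: compl matrix_mul_rid)
    have "A = peval A [:0, 1:]"
      by simp
    then show "A ** P = P ** A"
      unfolding P_def by (metis peval_commute)
    show "peval A ([:- z, 1:] ^ m) ** P = 0"
      using zero[of v] unfolding P_def by (simp only: peval_mult matrix_mul_assoc)
    show "\<forall>w. P *v w = 0 \<longrightarrow> A *v w = z *s w \<longrightarrow> w = 0"
    proof safe
      fix w assume w: "P *v w = 0" "A *v w = z *s w"
      have "poly (u * [:- z, 1:] ^ m) z = 0"
        using \<open>m \<noteq> 0\<close> by simp
      then have "peval A (u * [:- z, 1:] ^ m) *v w = 0"
        by (metis peval_eigenvector[OF w(2)] vec.scale_zero_left)
      then have "(P + peval A (u * [:- z, 1:] ^ m)) *v w = 0"
        using w(1) by (simp only: matrix_vector_mult_add_rdistrib add_0_right)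
      then show "w = 0"
        by (simp only: compl matrix_vector_mul_lid)
    qed
  qed
qed

section \<open>The matrix exponential\<close>

lemma bounded_bilinear_matrix_mult:
  "bounded_bilinear ((**) :: complex ^ 'n ^ 'n \<Rightarrow> complex ^ 'n ^ 'n \<Rightarrow> complex ^ 'n ^ 'n)"
  unfolding bilinear_conv_bounded_bilinear[symmetric] bilinear_def
  by (auto intro!: linearI simp: matrix_distribs matrix_scalar_ac scalar_matrix_assoc[symmetric])

lemmas matrix_has_vector_derivative_mult =
  bounded_bilinear.has_vector_derivative[OF bounded_bilinear_matrix_mult]

lemma bounded_linear_entry: "bounded_linear (\<lambda>M :: complex ^ 'n ^ 'n. M $ i $ j)"
  by (rule bounded_linear_compose[OF bounded_linear_vec_nth bounded_linear_vec_nth])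

lemma has_vector_derivative_vecI:
  fixes f :: "real \<Rightarrow> 'a::euclidean_space ^ 'n"
  assumes "\<And>i. ((\<lambda>t. f t $ i) has_vector_derivative D $ i) F"
  shows "(f has_vector_derivative D) F"
proof -
  have decomp: "x = (\<Sum>i\<in>UNIV. axis i (x $ i))" for x :: "'a ^ 'n"
    by (simp add: vec_eq_iff axis_def if_distrib cong: if_cong)
  have lin: "bounded_linear (axis i :: 'a \<Rightarrow> 'a ^ 'n)" for i
    by (auto intro!: linearI simp: linear_conv_bounded_linear[symmetric] axis_def vec_eq_iff)
  have "((\<lambda>t. axis i (f t $ i)) has_vector_derivative axis i (D $ i)) F" for i
    by (rule bounded_linear.has_vector_derivative[OF lin assms])
  then have "((\<lambda>t. \<Sum>i\<in>UNIV. axis i (f t $ i)) has_vector_derivative (\<Sum>i\<in>UNIV. axis i (D $ i))) F"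
    by (rule has_vector_derivative_sum)
  then show ?thesis
    by (simp flip: decomp)
qed

lemma has_vector_derivative_matrixI:
  fixes f :: "real \<Rightarrow> complex ^ 'n ^ 'n"
  assumes "\<And>i j. ((\<lambda>t. f t $ i $ j) has_vector_derivative D $ i $ j) F"
  shows "(f has_vector_derivative D) F"
  by (intro has_vector_derivative_vecI assms)

lemma matrix_power_scaleR: "matrix_power (t *\<^sub>R A) k = t ^ k *\<^sub>R matrix_power A k"
  by (induction k) (simp_all add: matrix_scalar_ac scalar_matrix_assoc[symmetric])

lemma norm_matrix_power_le:
  fixes A :: "complex ^ 'n ^ 'n"
  shows "\<exists>K. \<forall>k. norm (matrix_power A k) \<le> norm (mat 1 :: complex ^ 'n ^ 'n) * K ^ k"
proof -
  obtain K where "K > 0" and K: "\<forall>B C. norm ((B :: complex ^ 'n ^ 'n) ** (C :: complex ^ 'n ^ 'n)) \<le> norm B * norm C * K"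
    using bounded_bilinear.pos_bounded[OF bounded_bilinear_matrix_mult] by blast
  have "norm (matrix_power A k) \<le> norm (mat 1 :: complex ^ 'n ^ 'n) * (norm A * K) ^ k" for k
  proof (induction k)
    case (Suc k)
    have "norm (matrix_power A (Suc k)) \<le> norm A * K * norm (matrix_power A k)"
      using K[rule_format, of A "matrix_power A k"] by (simp add: mult_ac)
    also have "\<dots> \<le> norm A * K * (norm (mat 1 :: complex ^ 'n ^ 'n) * (norm A * K) ^ k)"
      using \<open>K > 0\<close> Suc by (intro mult_left_mono) auto
    finally show ?case by (simp add: mult_ac)
  qed simp
  then show ?thesis by (intro exI allI)
qed

lemma summable_matrix_exp:
  fixes A :: "complex ^ 'n ^ 'n"
  shows "summable (\<lambda>k. (1 / fact k) *\<^sub>R matrix_power A k)"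
proof -
  obtain K where K: "\<forall>k. norm (matrix_power A k) \<le> norm (mat 1 :: complex ^ 'n ^ 'n) * K ^ k"
    using norm_matrix_power_le[of A] ..
  have "summable (\<lambda>k. norm (mat 1 :: complex ^ 'n ^ 'n) * (inverse (fact k) * K ^ k))"
    by (intro summable_mult summable_exp)
  then show ?thesis
    by (rule summable_comparison_test[rotated])
      (use K in \<open>auto intro!: exI[of _ 0] simp: field_simps\<close>)
qed

lemma matrix_exp_0: "matrix_exp 0 = (mat 1 :: complex ^ 'n ^ 'n)"
proof -
  have "matrix_power 0 k = (if k = 0 then mat 1 else (0 :: complex ^ 'n ^ 'n))" for k
    by (cases k) auto
  then have "(\<lambda>k. (1 / fact k) *\<^sub>R matrix_power (0 :: complex ^ 'n ^ 'n) k) = (\<lambda>k. if k = 0 then mat 1 else 0)"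
    by auto
  then show ?thesis
    unfolding matrix_exp_def using suminf_finite[of "{0}" "\<lambda>k. if k = 0 then mat 1 else (0 :: complex ^ 'n ^ 'n)"]
    by simp
qed

text \<open>Each entry of \<open>exp(tA)\<close> is an entire power series in \<open>t\<close>, which is differentiated termwise.\<close>

lemma matrix_exp_has_vector_derivative:
  fixes A :: "complex ^ 'n ^ 'n"
  shows "((\<lambda>t. matrix_exp (t *\<^sub>R A)) has_vector_derivative A ** matrix_exp (t *\<^sub>R A)) (at t)"
proof (rule has_vector_derivative_matrixI)
  fix i j
  define c where "c = (\<lambda>k. (1 / fact k) *\<^sub>R matrix_power A k $ i $ j)"
  have term_eq: "((1 / fact k) *\<^sub>R matrix_power (s *\<^sub>R A) k) $ i $ j = c k * complex_of_real s ^ k" for s k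
    by (simp only: c_def matrix_power_scaleR vector_scaleR_component) (simp add: scaleR_conv_of_real)
  have entry: "matrix_exp (s *\<^sub>R A) $ i $ j = (\<Sum>k. c k * complex_of_real s ^ k)" for s
    using bounded_linear.suminf[OF bounded_linear_entry[of i j] summable_matrix_exp[of "s *\<^sub>R A"]]
    by (simp only: matrix_exp_def term_eq)
  have deriv: "(A ** matrix_exp (t *\<^sub>R A)) $ i $ j = (\<Sum>k. diffs c k * complex_of_real t ^ k)"
  proof -
    have "bounded_linear (\<lambda>M. (A ** M) $ i $ j)"
      using bounded_linear_compose[OF bounded_linear_entry
          bounded_bilinear.bounded_linear_right[OF bounded_bilinear_matrix_mult]] .
    from bounded_linear.suminf[OF this summable_matrix_exp[of "t *\<^sub>R A"]]
    have "(A ** matrix_exp (t *\<^sub>R A)) $ i $ j =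
        (\<Sum>k. (A ** ((1 / fact k) *\<^sub>R matrix_power (t *\<^sub>R A) k)) $ i $ j)"
      by (simp only: matrix_exp_def)
    moreover have "(A ** ((1 / fact k) *\<^sub>R matrix_power (t *\<^sub>R A) k)) $ i $ j = diffs c k * complex_of_real t ^ k" for k
    proof -
      have "A ** ((1 / fact k) *\<^sub>R matrix_power (t *\<^sub>R A) k) = (t ^ k / fact k) *\<^sub>R matrix_power A (Suc k)"
        by (simp add: matrix_power_scaleR matrix_scalar_ac scalar_matrix_assoc[symmetric])
      moreover have "diffs c k = (1 / fact k) *\<^sub>R matrix_power A (Suc k) $ i $ j"
        by (simp add: diffs_def c_def scaleR_conv_of_real field_simps del: matrix_power.simps of_nat_Suc)
      ultimately show ?thesis
        by (simp only: vector_scaleR_component) (simp add: scaleR_conv_of_real del: matrix_power.simps)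
    qed
    ultimately show ?thesis by simp
  qed
  have "summable (\<lambda>k. c k * y ^ k)" for y
  proof -
    obtain K where K: "\<forall>k. norm (matrix_power A k) \<le> norm (mat 1 :: complex ^ 'n ^ 'n) * K ^ k"
      using norm_matrix_power_le[of A] ..
    have "norm (c k * y ^ k) \<le> norm (mat 1 :: complex ^ 'n ^ 'n) * (inverse (fact k) * (K * norm y) ^ k)" for k
    proof -
      have "norm (matrix_power A k $ i $ j) \<le> norm (matrix_power A k)"
        by (rule order_trans[OF Finite_Cartesian_Product.norm_nth_le Finite_Cartesian_Product.norm_nth_le])
      with K have "norm (matrix_power A k $ i $ j) \<le> norm (mat 1 :: complex ^ 'n ^ 'n) * K ^ k"
        by (metis order_trans)
      then have "norm (matrix_power A k $ i $ j) * (inverse (fact k) * norm y ^ k)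
          \<le> norm (mat 1 :: complex ^ 'n ^ 'n) * K ^ k * (inverse (fact k) * norm y ^ k)"
        by (intro mult_right_mono) auto
      then show ?thesis
        by (simp add: c_def norm_mult norm_power power_mult_distrib field_simps)
    qed
    note bound = this
    have sum: "summable (\<lambda>k. norm (mat 1 :: complex ^ 'n ^ 'n) * (inverse (fact k) * (K * norm y) ^ k))"
      by (intro summable_mult summable_exp)
    show ?thesis
      by (rule summable_comparison_test'[OF sum, of 0]) (rule bound)
  qed
  from termdiffs_strong_converges_everywhere[OF this]
  show "((\<lambda>t. matrix_exp (t *\<^sub>R A) $ i $ j) has_vector_derivative (A ** matrix_exp (t *\<^sub>R A)) $ i $ j) (at t)"
    unfolding entry deriv by (rule has_vector_derivative_real_field)
qed

lemma matrix_exp_commute: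
  fixes A C :: "complex ^ 'n ^ 'n"
  assumes "C ** A = A ** C"
  shows "C ** matrix_exp A = matrix_exp A ** C"
proof -
  have "C ** matrix_power A k = matrix_power A k ** C" for k
  proof (induction k)
    case (Suc k)
    have "C ** matrix_power A (Suc k) = A ** (C ** matrix_power A k)"
      by (simp add: matrix_mul_assoc assms)
    then show ?case
      by (simp add: Suc matrix_mul_assoc)
  qed simp
  then have "C ** ((1 / fact k) *\<^sub>R matrix_power A k) = ((1 / fact k) *\<^sub>R matrix_power A k) ** C" for k
    by (simp add: matrix_scalar_ac scalar_matrix_assoc[symmetric])
  then show ?thesis
    unfolding matrix_exp_def
      bounded_linear.suminf[OF bounded_bilinear.bounded_linear_right[OF bounded_bilinear_matrix_mult] summable_matrix_exp]
      bounded_linear.suminf[OF bounded_bilinear.bounded_linear_left[OF bounded_bilinear_matrix_mult] summable_matrix_exp]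
    by simp
qed

lemma matrix_exp_commute_self: "A ** matrix_exp (t *\<^sub>R A) = matrix_exp (t *\<^sub>R A) ** A"
  by (rule matrix_exp_commute) (simp add: matrix_scalar_ac scalar_matrix_assoc[symmetric])

lemma matrix_exp_minus_has_vector_derivative:
  fixes A :: "complex ^ 'n ^ 'n"
  shows "((\<lambda>t. matrix_exp (- t *\<^sub>R A)) has_vector_derivative - (matrix_exp (- t *\<^sub>R A) ** A)) (at t)"
  using matrix_exp_has_vector_derivative[of "- A" t]
  by (simp add: matrix_minus_left matrix_exp_commute_self[of A "- t", simplified])

text \<open>The derivative of \<open>exp(-tA) Y(t)\<close> vanishes. All identities for the matrix exponential below
  come from this uniqueness statement.\<close>

lemma linear_ode_unique:
  fixes Y :: "real \<Rightarrow> complex ^ 'n ^ 'n"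
  assumes deriv: "\<And>t. (Y has_vector_derivative A ** Y t) (at t)"
  shows "matrix_exp (- t *\<^sub>R A) ** Y t = Y 0"
proof -
  have "((\<lambda>t. matrix_exp (- t *\<^sub>R A) ** Y t) has_vector_derivative 0) (at t)" for t
    using matrix_has_vector_derivative_mult[OF matrix_exp_minus_has_vector_derivative[of A t] deriv[of t]]
    by (simp add: matrix_mul_assoc matrix_minus_left)
  then obtain c where "\<And>t. matrix_exp (- t *\<^sub>R A) ** Y t = c"
    using has_vector_derivative_zero_constant[of UNIV "\<lambda>t. matrix_exp (- t *\<^sub>R A) ** Y t"] by auto
  from this[of t] this[of 0] show ?thesis
    by (simp add: matrix_exp_0)
qed

lemma matrix_exp_mult_minus:
  fixes A :: "complex ^ 'n ^ 'n"
  shows "matrix_exp (t *\<^sub>R A) ** matrix_exp (- t *\<^sub>R A) = mat 1"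
    and "matrix_exp (- t *\<^sub>R A) ** matrix_exp (t *\<^sub>R A) = mat 1"
proof -
  have *: "matrix_exp (- t *\<^sub>R A) ** matrix_exp (t *\<^sub>R A) = mat 1" for t
    using linear_ode_unique[OF matrix_exp_has_vector_derivative] by (simp add: matrix_exp_0)
  show "matrix_exp (- t *\<^sub>R A) ** matrix_exp (t *\<^sub>R A) = mat 1"
    by (rule *)
  show "matrix_exp (t *\<^sub>R A) ** matrix_exp (- t *\<^sub>R A) = mat 1"
    using *[of "- t"] by simp
qed

lemma matrix_exp_unique:
  fixes Y :: "real \<Rightarrow> complex ^ 'n ^ 'n"
  assumes "\<And>t. (Y has_vector_derivative A ** Y t) (at t)" "Y 0 = mat 1"
  shows "matrix_exp (t *\<^sub>R A) = Y t"
proof -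
  have "matrix_exp (t *\<^sub>R A) ** (matrix_exp (- t *\<^sub>R A) ** Y t) = matrix_exp (t *\<^sub>R A)"
    using linear_ode_unique[OF assms(1)] assms(2) by simp
  then show ?thesis
    by (simp only: matrix_mul_assoc matrix_exp_mult_minus matrix_mul_lid)
qed

lemma invertible_matrix_exp: "invertible (matrix_exp (t *\<^sub>R A))"
  using matrix_exp_mult_minus unfolding invertible_def by blast

lemma matrix_exp_add:
  fixes A :: "complex ^ 'n ^ 'n"
  shows "matrix_exp ((s + t) *\<^sub>R A) = matrix_exp (s *\<^sub>R A) ** matrix_exp (t *\<^sub>R A)"
proof -
  have "((\<lambda>s. matrix_exp ((s + t) *\<^sub>R A)) has_vector_derivative A ** matrix_exp ((s + t) *\<^sub>R A)) (at s)" for s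
  proof -
    have "((\<lambda>s. s + t) has_vector_derivative 1) (at s)"
      by (auto intro!: derivative_eq_intros)
    from vector_diff_chain_at[OF this matrix_exp_has_vector_derivative[of A]]
    show ?thesis by (simp add: o_def)
  qed
  then have "matrix_exp (- s *\<^sub>R A) ** matrix_exp ((s + t) *\<^sub>R A) = matrix_exp (t *\<^sub>R A)"
    using linear_ode_unique[of "\<lambda>s. matrix_exp ((s + t) *\<^sub>R A)" A s] by simp
  then have "matrix_exp (s *\<^sub>R A) ** (matrix_exp (- s *\<^sub>R A) ** matrix_exp ((s + t) *\<^sub>R A))
      = matrix_exp (s *\<^sub>R A) ** matrix_exp (t *\<^sub>R A)"
    by simp
  then show ?thesis
    by (simp only: matrix_mul_assoc matrix_exp_mult_minus matrix_mul_lid)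
qed

lemma matrix_exp_similar:
  fixes A S T :: "complex ^ 'n ^ 'n"
  assumes "S ** T = mat 1"
  shows "matrix_exp (t *\<^sub>R (T ** A ** S)) = T ** matrix_exp (t *\<^sub>R A) ** S"
proof (rule matrix_exp_unique)
  have "T ** S = mat 1"
    using assms by (simp only: matrix_left_right_inverse[of S T])
  then show "T ** matrix_exp (0 *\<^sub>R A) ** S = mat 1"
    by (simp add: matrix_exp_0)
  have lin: "bounded_linear (\<lambda>M. T ** M ** S)"
    by (intro bounded_linear_compose[OF bounded_bilinear.bounded_linear_left[OF bounded_bilinear_matrix_mult]]
        bounded_bilinear.bounded_linear_right[OF bounded_bilinear_matrix_mult])
  have "T ** A ** S ** (T ** matrix_exp (t *\<^sub>R A) ** S) = T ** A ** (S ** T) ** matrix_exp (t *\<^sub>R A) ** S" for t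
    by (simp add: matrix_mul_assoc)
  then show "((\<lambda>t. T ** matrix_exp (t *\<^sub>R A) ** S) has_vector_derivative
      T ** A ** S ** (T ** matrix_exp (t *\<^sub>R A) ** S)) (at t)" for t
    using bounded_linear.has_vector_derivative[OF lin matrix_exp_has_vector_derivative[of A t]]
    by (simp add: assms matrix_mul_assoc)
qed

section \<open>Functions on the torus along a dense orbit\<close>

definition frequencies :: "real ^ 'd \<Rightarrow> real set" where
  "frequencies \<omega> = {2 * pi * (k \<bullet> \<omega>) | k. k \<in> int_lattice}"

lemma int_lattice_axis: "axis i 1 \<in> int_lattice"
  by (simp add: int_lattice_def axis_def)

lemma int_lattice_add: "k \<in> int_lattice \<Longrightarrow> l \<in> int_lattice \<Longrightarrow> k + l \<in> int_lattice"
  by (simp add: int_lattice_def)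

lemma int_lattice_minus: "k \<in> int_lattice \<Longrightarrow> - k \<in> int_lattice"
  by (simp add: int_lattice_def)

lemma torus_mapD: "torus_map f \<Longrightarrow> k \<in> int_lattice \<Longrightarrow> f (\<theta> + k) = f \<theta>"
  by (simp add: torus_map_def)

text \<open>Kronecker's theorem. The coordinates of \<open>\<omega>\<close> are pairwise distinct and linearly independent over
  \<open>\<int>\<close>, since an integral relation between them is an integral vector orthogonal to \<open>\<omega>\<close>.\<close>

lemma orbit_dense:
  fixes \<omega> \<phi> :: "real ^ 'd"
  assumes indep: "rationally_independent \<omega>" and "\<epsilon> > 0"
  obtains t k where "k \<in> int_lattice" "norm (t *\<^sub>R \<omega> + k - \<phi>) < \<epsilon>"
proof -
  interpret Modules.module "\<lambda>r. (*) (real_of_int r)"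
    by unfold_locales (simp_all add: distrib_left distrib_right)
  define n where "n = CARD('d)"
  obtain e where e: "bij_betw e {..<n} (UNIV :: 'd set)"
    unfolding n_def using ex_bij_betw_nat_finite[of "UNIV :: 'd set"] by (auto simp: atLeast0LessThan)
  have "(k \<bullet> \<omega>) \<noteq> 0" if "k \<in> int_lattice" "k \<noteq> 0" for k
    using indep that by (auto simp: rationally_independent_def)
  note nz = this
  have inj: "inj (\<lambda>i. \<omega> $ i)"
  proof (rule injI, rule ccontr)
    fix i j assume ij: "\<omega> $ i = \<omega> $ j" "i \<noteq> j"
    have "axis i 1 + - axis j 1 \<in> (int_lattice :: (real ^ 'd) set)"
      by (intro int_lattice_add int_lattice_minus int_lattice_axis)
    moreover have "(axis i 1 + - axis j 1 :: real ^ 'd) \<noteq> 0"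
      using ij(2) by (auto simp: vec_eq_iff axis_def)
    moreover have "(axis i 1 + - axis j 1) \<bullet> \<omega> = 0"
      using ij(1) by (simp add: inner_diff_left inner_axis')
    ultimately show False using nz by blast
  qed
  have img: "(\<lambda>i. \<omega> $ e i) ` {..<n} = range (\<lambda>i. \<omega> $ i)"
    using e by (simp add: bij_betw_def flip: image_image)
  have "independent (range (\<lambda>i. \<omega> $ i))"
  proof
    assume "dependent (range (\<lambda>i. \<omega> $ i))"
    then obtain u v where uv: "v \<in> range (\<lambda>i. \<omega> $ i)" "u v \<noteq> 0"
      "(\<Sum>v\<in>range (\<lambda>i. \<omega> $ i). real_of_int (u v) * v) = 0"
      by (subst (asm) dependent_finite) auto
    define k :: "real ^ 'd" where "k = (\<chi> i. real_of_int (u (\<omega> $ i)))"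
    have "k \<in> int_lattice" "k \<noteq> 0"
      using uv(1,2) by (auto simp: k_def int_lattice_def vec_eq_iff)
    moreover have "k \<bullet> \<omega> = 0"
      using uv(3) inj by (simp add: k_def inner_vec_def sum.reindex)
    ultimately show False using nz by blast
  qed
  moreover have "inj_on (\<lambda>i. \<omega> $ e i) {..<n}"
    using e inj by (auto simp: inj_on_def bij_betw_def)
  moreover have "\<epsilon> / n > 0"
    using assms(2) by (simp add: n_def)
  ultimately obtain t h where th: "\<And>i. i < n \<Longrightarrow> \<bar>t * \<omega> $ e i - of_int (h i) - \<phi> $ e i\<bar> < \<epsilon> / n"
    using Kronecker_thm_1[of "\<lambda>i. \<omega> $ e i" n "\<epsilon> / n" "\<lambda>i. \<phi> $ e i"] unfolding img by blast
  define k :: "real ^ 'd" where "k = (\<chi> j. - of_int (h (inv_into {..<n} e j)))"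
  have comp: "\<bar>(t *\<^sub>R \<omega> + k - \<phi>) $ j\<bar> < \<epsilon> / n" for j
  proof -
    have "inv_into {..<n} e j < n" "e (inv_into {..<n} e j) = j"
      using e bij_betw_inv_into_right[OF e, of j] inv_into_into[of j e "{..<n}"]
      by (auto simp: bij_betw_def)
    with th[of "inv_into {..<n} e j"] show ?thesis
      by (simp add: k_def)
  qed
  have "norm (t *\<^sub>R \<omega> + k - \<phi>) \<le> (\<Sum>j\<in>UNIV. \<bar>(t *\<^sub>R \<omega> + k - \<phi>) $ j\<bar>)"
    by (rule norm_le_l1_cart)
  also have "\<dots> < (\<Sum>j\<in>(UNIV :: 'd set). \<epsilon> / n)"
    using comp by (intro sum_strict_mono) auto
  also have "\<dots> = \<epsilon>"
    by (simp add: n_def)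
  finally show thesis
    using that[of k t] by (auto simp: k_def int_lattice_def)
qed

lemma torus_map_eqI:
  fixes f g :: "real ^ 'd \<Rightarrow> 'a::t2_space"
  assumes \<omega>: "rationally_independent \<omega>"
    and "torus_map f" "torus_map g" "continuous_on UNIV f" "continuous_on UNIV g"
    and eq: "\<And>t. f (t *\<^sub>R \<omega>) = g (t *\<^sub>R \<omega>)"
  shows "f \<theta> = g \<theta>"
proof -
  have "closed {x. f x = g x}"
    using assms by (intro closed_Collect_eq) auto
  moreover have "\<theta> \<in> closure {x. f x = g x}"
    unfolding closure_approachable
  proof safe
    fix \<epsilon> :: real assume "\<epsilon> > 0"
    then obtain t k where k: "k \<in> int_lattice" "norm (t *\<^sub>R \<omega> + k - \<theta>) < \<epsilon>"
      using orbit_dense[OF \<omega>] by blast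
    then have "f (t *\<^sub>R \<omega> + k) = g (t *\<^sub>R \<omega> + k)"
      using assms by (simp add: torus_mapD)
    with k show "\<exists>y\<in>{x. f x = g x}. dist y \<theta> < \<epsilon>"
      by (auto simp: dist_norm)
  qed
  ultimately show ?thesis by simp
qed

lemma torus_map_bounded:
  fixes f :: "real ^ 'd \<Rightarrow> 'a::real_normed_vector"
  assumes "torus_map f" "continuous_on UNIV f"
  shows "\<exists>K. \<forall>\<theta>. norm (f \<theta>) \<le> K"
proof -
  have "compact (f ` cbox 0 (\<chi> i. 1))"
    using assms(2) by (intro compact_continuous_image compact_cbox) (auto intro: continuous_on_subset)
  then obtain K where K: "\<And>x. x \<in> cbox 0 (\<chi> i. 1) \<Longrightarrow> norm (f x) \<le> K"
    using compact_imp_bounded[of "f ` cbox 0 (\<chi> i. 1)"] by (auto simp: bounded_iff)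
  have "norm (f \<theta>) \<le> K" for \<theta>
  proof -
    have "(\<chi> i. - of_int \<lfloor>\<theta> $ i\<rfloor>) \<in> (int_lattice :: (real ^ 'd) set)"
      by (simp add: int_lattice_def)
    then have "f (\<theta> + (\<chi> i. - of_int \<lfloor>\<theta> $ i\<rfloor>)) = f \<theta>"
      using assms(1) by (rule torus_mapD[rotated])
    moreover have "\<theta> + (\<chi> i. - of_int \<lfloor>\<theta> $ i\<rfloor>) \<in> cbox 0 (\<chi> i. 1)"
    proof -
      have "0 \<le> \<theta> $ i - of_int \<lfloor>\<theta> $ i\<rfloor>" "\<theta> $ i - of_int \<lfloor>\<theta> $ i\<rfloor> \<le> 1" for i
        by linarith+
      then show ?thesis by (simp add: mem_box_cart)
    qed
    ultimately show ?thesis using K by metis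
  qed
  then show ?thesis by blast
qed

text \<open>The values lie in the discrete set \<open>2\<pi>i\<int>\<close>.\<close>

lemma continuous_exp_eq_1_constant:
  fixes F :: "'a::real_normed_vector \<Rightarrow> complex"
  assumes "continuous_on UNIV F" "\<And>x. exp (F x) = 1"
  shows "F x = F y"
proof -
  have "F constant_on UNIV"
  proof (rule continuous_discrete_range_constant[OF connected_UNIV assms(1)])
    fix x :: 'a
    have "2 * pi \<le> norm (F y - F x)" if ne: "F y \<noteq> F x" for y
    proof -
      obtain m n where mn: "Re (F x) = 0" "Im (F x) = of_int (2 * m) * pi" "Re (F y) = 0" "Im (F y) = of_int (2 * n) * pi"
        using assms(2)[of x] assms(2)[of y] unfolding exp_eq_1 by blast
      have diff: "Im (F y - F x) = real_of_int (n - m) * (2 * pi)"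
        by (simp add: mn algebra_simps)
      have "m \<noteq> n"
        using mn ne by (auto simp: complex_eq_iff)
      then have "1 \<le> \<bar>real_of_int (n - m)\<bar>" by linarith
      then have "2 * pi \<le> \<bar>real_of_int (n - m)\<bar> * (2 * pi)" by simp
      also have "\<dots> = \<bar>Im (F y - F x)\<bar>"
        by (simp only: diff abs_mult) simp
      also have "\<dots> \<le> norm (F y - F x)" by (rule abs_Im_le_cmod)
      finally show ?thesis .
    qed
    then show "\<exists>e>0. \<forall>y. y \<in> UNIV \<and> F y \<noteq> F x \<longrightarrow> e \<le> norm (F y - F x)"
      by (intro exI[of _ "2 * pi"]) auto
  qed
  then show ?thesis by (auto simp: constant_on_def)
qed

text \<open>Such a function is bounded, but \<open>D(nx) = n D(x)\<close>.\<close>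

lemma additive_torus_map_zero:
  fixes D :: "real ^ 'd \<Rightarrow> complex"
  assumes "torus_map D" "continuous_on UNIV D" and add: "\<And>x y. D (x + y) = D x + D y"
  shows "D x = 0"
proof (rule ccontr)
  assume "D x \<noteq> 0"
  obtain K where K: "\<And>\<theta>. norm (D \<theta>) \<le> K"
    using torus_map_bounded[OF assms(1,2)] by blast
  obtain n :: nat where n: "K < real n * norm (D x)"
    using reals_Archimedean3[of "norm (D x)"] \<open>D x \<noteq> 0\<close> by auto
  have "D 0 = 0" using add[of 0 0] by simp
  then have "D (real m *\<^sub>R x) = of_nat m * D x" for m
    by (induction m) (simp_all add: add scaleR_left_distrib distrib_right)
  then have "norm (D (real n *\<^sub>R x)) = real n * norm (D x)"
    by (simp add: norm_mult)
  with K[of "real n *\<^sub>R x"] n show False by simp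
qed

text \<open>The difference of the two sides is additive and vanishes at the unit vectors, hence on the
  lattice; so it is a function on the torus and \<open>additive_torus_map_zero\<close> applies.\<close>

lemma additive_continuous_sum:
  fixes l :: "real ^ 'd \<Rightarrow> complex"
  assumes "continuous_on UNIV l" and add: "\<And>x y. l (x + y) = l x + l y"
  shows "l x = (\<Sum>i\<in>UNIV. x $ i *\<^sub>R l (axis i 1))"
proof -
  define D where "D = (\<lambda>x. l x - (\<Sum>i\<in>UNIV. x $ i *\<^sub>R l (axis i 1)))"
  have D_add: "D (x + y) = D x + D y" for x y
    by (simp add: D_def add scaleR_left_distrib sum.distrib)
  have D0: "D 0 = 0" using D_add[of 0 0] by simp
  have D_minus: "D (- x) = - D x" for x
    using D_add[of x "- x"] D0 by (simp add: add_eq_0_iff2)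
  have D_axis: "D (axis i 1) = 0" for i
    by (simp add: D_def axis_def if_distrib[of "\<lambda>x. x *\<^sub>R _"] cong: if_cong)
  have nat: "D (real m *\<^sub>R axis i 1) = 0" for m i
    by (induction m) (simp_all add: D0 D_add D_axis scaleR_left_distrib)
  have int: "D (axis i c) = 0" if c: "c \<in> \<int>" for i c
  proof -
    have "axis i c = c *\<^sub>R axis i 1"
      by (simp add: axis_def vec_eq_iff)
    moreover obtain m where "c = of_int m"
      using c by (auto simp: Ints_def)
    then have "c = real (nat m) \<or> c = - real (nat (- m))" by auto
    ultimately show ?thesis using nat D_minus by auto
  qed
  have "D k = 0" if "k \<in> int_lattice" for k
  proof -
    have "D (\<Sum>i\<in>S. axis i (k $ i)) = 0" if "finite S" for S
      using that \<open>k \<in> int_lattice\<close>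
      by (induction S rule: finite_induct) (auto simp: D0 D_add int_lattice_def int)
    moreover have "k = (\<Sum>i\<in>UNIV. axis i (k $ i))"
      by (simp add: vec_eq_iff axis_def if_distrib cong: if_cong)
    ultimately show ?thesis by (metis finite)
  qed
  then have "torus_map D"
    by (simp add: torus_map_def D_add)
  moreover have "continuous_on UNIV D"
    unfolding D_def by (intro continuous_intros assms)
  ultimately have "D x = 0"
    using D_add by (rule additive_torus_map_zero)
  then show ?thesis by (simp add: D_def)
qed

text \<open>Boundedness forces \<open>Re \<nu> = 0\<close>, so \<open>|g|\<close> is invariant under the flow, hence constant by
  density, and \<open>h = g/g(0)\<close> is defined and nonzero everywhere. It is multiplicative because it is
  so along the dense orbit. A continuous logarithm \<open>l\<close> of \<open>h\<close> is therefore linear; it takes values in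
  \<open>2\<pi>i\<int>\<close> at the unit vectors, and \<open>\<nu> = l(\<omega>)\<close>.\<close>

lemma torus_eigenfunction:
  fixes g :: "real ^ 'd \<Rightarrow> complex"
  assumes \<omega>: "rationally_independent \<omega>" and g: "torus_map g" "continuous_on UNIV g"
    and shift: "\<And>\<theta> t. g (\<theta> + t *\<^sub>R \<omega>) = exp (of_real t * \<nu>) * g \<theta>"
    and nz: "g \<theta> \<noteq> 0"
  shows "Re \<nu> = 0 \<and> Im \<nu> \<in> frequencies \<omega>"
proof -
  obtain K where K: "\<And>\<theta>. norm (g \<theta>) \<le> K"
    using torus_map_bounded[OF g] by blast
  have Re: "Re \<nu> = 0"
  proof (rule ccontr)
    assume "Re \<nu> \<noteq> 0"
    define c where "c = norm (g \<theta>)"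
    have "c > 0" using nz by (simp add: c_def)
    have "K \<ge> c" unfolding c_def by (rule K)
    with \<open>c > 0\<close> have "K > 0" by linarith
    \<comment> \<open>At this time the modulus has grown from \<open>c\<close> to \<open>2K\<close>.\<close>
    define t where "t = ln (2 * K / c) / Re \<nu>"
    have "norm (g (\<theta> + t *\<^sub>R \<omega>)) = exp (t * Re \<nu>) * c"
      by (simp add: shift norm_mult c_def)
    also have "\<dots> = 2 * K"
      using \<open>Re \<nu> \<noteq> 0\<close> \<open>K > 0\<close> \<open>c > 0\<close> by (simp add: t_def)
    finally show False using K[of "\<theta> + t *\<^sub>R \<omega>"] \<open>K > 0\<close> by simp
  qed
  have orbit: "g (t *\<^sub>R \<omega>) = exp (of_real t * \<nu>) * g 0" for t
    using shift[of 0 t] by simp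
  have "norm (g \<theta>) = norm (g 0)"
  proof (rule torus_map_eqI[OF \<omega>, where f = "\<lambda>\<theta>. norm (g \<theta>)" and g = "\<lambda>_. norm (g 0)"])
    show "torus_map (\<lambda>\<theta>. norm (g \<theta>))" using g by (simp add: torus_map_def)
    show "continuous_on UNIV (\<lambda>\<theta>. norm (g \<theta>))" using g(2) by (intro continuous_intros)
    show "norm (g (t *\<^sub>R \<omega>)) = norm (g 0)" for t by (simp add: orbit norm_mult Re)
  qed (simp_all add: torus_map_def)
  then have g0: "g 0 \<noteq> 0" using nz by auto
  define h where "h = (\<lambda>\<theta>. g \<theta> / g 0)"
  have h: "torus_map h" "continuous_on UNIV h"
    using g g0 by (auto simp: h_def torus_map_def intro!: continuous_intros)
  have h_mult: "h (\<theta> + \<phi>) = h \<theta> * h \<phi>" for \<theta> \<phi>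
  proof (rule torus_map_eqI[OF \<omega>, where f = "\<lambda>\<phi>. h (\<theta> + \<phi>)" and g = "\<lambda>\<phi>. h \<theta> * h \<phi>"])
    show "torus_map (\<lambda>\<phi>. h (\<theta> + \<phi>))" "torus_map (\<lambda>\<phi>. h \<theta> * h \<phi>)"
      using h(1) by (simp_all add: torus_map_def flip: add.assoc)
    show "continuous_on UNIV (\<lambda>\<phi>. h (\<theta> + \<phi>))" "continuous_on UNIV (\<lambda>\<phi>. h \<theta> * h \<phi>)"
      using h(2) by (auto intro!: continuous_intros continuous_on_compose2[OF h(2)])
    show "h (\<theta> + t *\<^sub>R \<omega>) = h \<theta> * h (t *\<^sub>R \<omega>)" for t
      using g0 by (simp add: h_def shift orbit)
  qed
  have "h 0 = 1" using g0 by (simp add: h_def)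
  have "h \<theta> \<noteq> 0" for \<theta>
    using h_mult[of \<theta> "- \<theta>"] \<open>h 0 = 1\<close> by auto
  then obtain L where L: "continuous_on UNIV L" "\<And>\<theta>. h \<theta> = exp (L \<theta>)"
    using continuous_logarithm_on_contractible[OF h(2) convex_imp_contractible[OF convex_UNIV]] by auto
  define l where "l = (\<lambda>\<theta>. L \<theta> - L 0)"
  have l: "continuous_on UNIV l" "h \<theta> = exp (l \<theta>)" "l 0 = 0" for \<theta>
    using L \<open>h 0 = 1\<close> by (auto simp: l_def exp_diff intro!: continuous_intros)
  have l_add: "l (\<theta> + \<phi>) = l \<theta> + l \<phi>" for \<theta> \<phi>
  proof -
    have "l (\<theta> + \<phi>) - l \<theta> - l \<phi> = l (\<theta> + 0) - l \<theta> - l 0"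
    proof (rule continuous_exp_eq_1_constant[of "\<lambda>\<phi>. l (\<theta> + \<phi>) - l \<theta> - l \<phi>"])
      show "continuous_on UNIV (\<lambda>\<phi>. l (\<theta> + \<phi>) - l \<theta> - l \<phi>)"
        by (auto intro!: continuous_intros l(1) continuous_on_compose2[OF l(1)])
      show "exp (l (\<theta> + \<phi>) - l \<theta> - l \<phi>) = 1" for \<phi>
        using h_mult[of \<theta> \<phi>] by (simp add: exp_diff l(2))
    qed
    then show ?thesis by (simp add: l(3) algebra_simps)
  qed
  have "l (1 *\<^sub>R \<omega>) - of_real 1 * \<nu> = l (0 *\<^sub>R \<omega>) - of_real 0 * \<nu>"
  proof (rule continuous_exp_eq_1_constant[of "\<lambda>t. l (t *\<^sub>R \<omega>) - of_real t * \<nu>"])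
    show "continuous_on UNIV (\<lambda>t. l (t *\<^sub>R \<omega>) - of_real t * \<nu>)"
      by (auto intro!: continuous_intros continuous_on_compose2[OF l(1)])
    show "exp (l (t *\<^sub>R \<omega>) - of_real t * \<nu>) = 1" for t
      using g0 by (simp add: exp_diff flip: l(2)) (simp add: h_def orbit)
  qed
  then have "\<nu> = l \<omega>" by (simp add: l(3))
  also have "\<dots> = (\<Sum>i\<in>UNIV. \<omega> $ i *\<^sub>R l (axis i 1))"
    by (rule additive_continuous_sum[OF l(1) l_add])
  finally have \<nu>: "\<nu> = (\<Sum>i\<in>UNIV. \<omega> $ i *\<^sub>R l (axis i 1))" .
  have "\<exists>m :: int. Im (l (axis i 1)) = 2 * pi * m" for i
  proof -
    have "h (axis i 1) = 1"
      using torus_mapD[OF h(1) int_lattice_axis, of 0 i] \<open>h 0 = 1\<close> by simp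
    then show ?thesis unfolding l(2) exp_eq_1 by (auto simp: mult_ac)
  qed
  then obtain m :: "'d \<Rightarrow> int" where m: "\<And>i. Im (l (axis i 1)) = 2 * pi * m i" by metis
  have "Im \<nu> = 2 * pi * ((\<chi> i. real_of_int (m i)) \<bullet> \<omega>)"
    by (simp add: \<nu> m inner_vec_def sum_distrib_left mult_ac)
  then have "Im \<nu> \<in> frequencies \<omega>"
    by (auto simp: frequencies_def int_lattice_def)
  with Re show ?thesis ..
qed

text \<open>For \<open>\<nu> = 0\<close> the solution grows linearly along the flow unless \<open>c = 0\<close>, and is then constant on a
  dense orbit. For \<open>\<nu> \<noteq> 0\<close> the function \<open>f + c/\<nu>\<close> is an eigenfunction of the flow, which the condition
  on \<open>\<nu>\<close> forces to vanish.\<close>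

lemma torus_scalar_ode_constant:
  fixes f :: "real ^ 'd \<Rightarrow> complex"
  assumes \<omega>: "rationally_independent \<omega>" and f: "torus_map f" "continuous_on UNIV f"
    and deriv: "\<And>\<theta> t. ((\<lambda>s. f (\<theta> + s *\<^sub>R \<omega>)) has_vector_derivative \<nu> * f (\<theta> + t *\<^sub>R \<omega>) + c) (at t)"
    and nonres: "Im \<nu> \<in> frequencies \<omega> \<Longrightarrow> Im \<nu> = 0"
  shows "f \<theta> = f 0"
proof (cases "\<nu> = 0")
  case True
  have affine: "f (t *\<^sub>R \<omega>) = f 0 + of_real t * c" for t
  proof -
    have "((\<lambda>s. f (s *\<^sub>R \<omega>) - of_real s * c) has_vector_derivative 0) (at t)" for t
    proof -
      have "((\<lambda>s. of_real s * c) has_vector_derivative c) (at t)"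
        by (auto intro!: derivative_eq_intros)
      with deriv[of 0 t] show ?thesis
        using has_vector_derivative_diff[of "\<lambda>s. f (s *\<^sub>R \<omega>)" c "at t" "\<lambda>s. of_real s * c" c] by (simp add: True)
    qed
    then obtain C where "\<And>t. f (t *\<^sub>R \<omega>) - of_real t * c = C"
      using has_vector_derivative_zero_constant[of UNIV "\<lambda>s. f (s *\<^sub>R \<omega>) - of_real s * c"] by auto
    from this[of t] this[of 0] show ?thesis by (simp add: algebra_simps)
  qed
  have "c = 0"
  proof (rule ccontr)
    assume "c \<noteq> 0"
    obtain K where K: "\<And>\<theta>. norm (f \<theta>) \<le> K"
      using torus_map_bounded[OF f] by blast
    have "K \<ge> 0" using K[of 0] norm_ge_zero order_trans by blast
    define t where "t = (2 * K + 1) / norm c"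
    have "norm (of_real t * c) = \<bar>t\<bar> * norm c"
      by (simp add: norm_mult)
    also have "\<dots> = 2 * K + 1"
      using \<open>c \<noteq> 0\<close> \<open>K \<ge> 0\<close> by (simp add: t_def)
    finally have "norm (of_real t * c) = 2 * K + 1" .
    moreover have "norm (of_real t * c) \<le> norm (f (t *\<^sub>R \<omega>)) + norm (f 0)"
      using norm_triangle_ineq4[of "f (t *\<^sub>R \<omega>)" "f 0"] by (simp add: affine)
    ultimately show False
      using K[of "t *\<^sub>R \<omega>"] K[of 0] by simp
  qed
  show ?thesis
  proof (rule torus_map_eqI[OF \<omega> f(1) _ f(2), where g = "\<lambda>_. f 0"])
    show "f (t *\<^sub>R \<omega>) = f 0" for t
      using affine[of t] \<open>c = 0\<close> by simp
  qed (simp_all add: torus_map_def)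
next
  case False
  define g where "g = (\<lambda>\<theta>. f \<theta> + c / \<nu>)"
  have g: "torus_map g" "continuous_on UNIV g"
    using f by (auto simp: g_def torus_map_def intro!: continuous_intros)
  have shift: "g (\<theta> + t *\<^sub>R \<omega>) = exp (of_real t * \<nu>) * g \<theta>" for \<theta> t
  proof -
    have "((\<lambda>s. exp (- (of_real s * \<nu>)) * g (\<theta> + s *\<^sub>R \<omega>)) has_vector_derivative 0) (at t)" for t
    proof -
      have "((\<lambda>s. exp (- (of_real s * \<nu>))) has_vector_derivative - \<nu> * exp (- (of_real t * \<nu>))) (at t)"
        by (rule has_vector_derivative_real_field[of "\<lambda>z. exp (- (z * \<nu>))"])
          (auto intro!: derivative_eq_intros)
      moreover have "((\<lambda>s. g (\<theta> + s *\<^sub>R \<omega>)) has_vector_derivative \<nu> * g (\<theta> + t *\<^sub>R \<omega>)) (at t)"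
        using deriv[of \<theta> t] False unfolding g_def
        by (auto simp: distrib_left intro!: derivative_eq_intros)
      ultimately show ?thesis
        using has_vector_derivative_mult by fastforce
    qed
    then obtain C where C: "\<And>t. exp (- (of_real t * \<nu>)) * g (\<theta> + t *\<^sub>R \<omega>) = C"
      using has_vector_derivative_zero_constant[of UNIV "\<lambda>s. exp (- (of_real s * \<nu>)) * g (\<theta> + s *\<^sub>R \<omega>)"] by auto
    from C[of t] C[of 0] show ?thesis
      by (simp add: exp_minus field_simps)
  qed
  have "g \<theta> = 0" for \<theta>
  proof (rule ccontr)
    assume "g \<theta> \<noteq> 0"
    with torus_eigenfunction[OF \<omega> g shift] have "Re \<nu> = 0" "Im \<nu> \<in> frequencies \<omega>"
      by blast+
    with nonres False show False by (simp add: complex_eq_iff)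
  qed
  then have "f \<theta> = - (c / \<nu>)" for \<theta>
    by (simp add: g_def add_eq_0_iff2)
  then show ?thesis by simp
qed

section \<open>Intertwiners of linear flows over the torus\<close>

lemma matrix_mult_continuous_on [continuous_intros]:
  fixes f g :: "'a::topological_space \<Rightarrow> complex ^ 'n ^ 'n"
  assumes "continuous_on S f" "continuous_on S g"
  shows "continuous_on S (\<lambda>x. f x ** g x)"
  by (rule bounded_bilinear.continuous_on[OF bounded_bilinear_matrix_mult assms])

text \<open>Induction on the degrees. For roots \<open>z\<close> of \<open>p\<close> and \<open>w\<close> of \<open>q\<close>, the functions \<open>(A - z) M\<close> and
  \<open>M (B - w)\<close> are intertwiners annihilated by polynomials of smaller degree, hence constant. Their
  difference is \<open>A M - M B - (z - w) M\<close>, so every entry of \<open>M\<close> satisfies the scalar equation with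
  \<open>\<nu> = z - w\<close>. Requiring both annihilation conditions makes the base case trivial: a nonzero constant
  polynomial annihilates only \<open>M = 0\<close>.\<close>

lemma intertwiner_constant_annihilated:
  fixes M :: "real ^ 'd \<Rightarrow> complex ^ 'n ^ 'n"
  assumes \<omega>: "rationally_independent \<omega>"
  shows "\<lbrakk>torus_map M; continuous_on UNIV M;
     \<And>\<theta> t. ((\<lambda>s. M (\<theta> + s *\<^sub>R \<omega>)) has_vector_derivative A ** M (\<theta> + t *\<^sub>R \<omega>) - M (\<theta> + t *\<^sub>R \<omega>) ** B) (at t);
     p \<noteq> 0; q \<noteq> 0; \<And>\<theta>. peval A p ** M \<theta> = 0; \<And>\<theta>. M \<theta> ** peval B q = 0;
     \<And>z w. poly p z = 0 \<Longrightarrow> poly q w = 0 \<Longrightarrow> Im (z - w) \<in> frequencies \<omega> \<Longrightarrow> Im (z - w) = 0\<rbrakk>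
    \<Longrightarrow> M \<theta> = M 0"
proof (induction "degree p + degree q" arbitrary: M p q \<theta> rule: less_induct)
  case less
  note M = less.prems(1,2) and deriv = less.prems(3) and nz = less.prems(4,5)
    and ann = less.prems(6,7) and nonres = less.prems(8)
  have scalar_ann: "N = 0" if "a \<noteq> 0" "mat a ** N = 0" for a and N :: "complex ^ 'n ^ 'n"
    using that by (simp add: vec_eq_iff mat_mult_component)
  show ?case
  proof (cases "degree p = 0 \<or> degree q = 0")
    case True
    have "M \<theta> = 0" for \<theta>
    proof (cases "degree p = 0")
      case True
      then obtain a where "p = [:a:]" by (rule degree_eq_zeroE)
      with nz(1) ann(1)[of \<theta>] scalar_ann[of a "M \<theta>"] show ?thesis by simp
    next
      case False
      with \<open>degree p = 0 \<or> degree q = 0\<close> obtain a where "q = [:a:]"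
        by (auto elim: degree_eq_zeroE)
      with nz(2) ann(2)[of \<theta>] scalar_ann[of a "M \<theta>"] show ?thesis by (simp add: mat_commute)
    qed
    then show ?thesis by simp
  next
    case False
    then obtain z w where zw: "poly p z = 0" "poly q w = 0"
      using fundamental_theorem_of_algebra[of p] fundamental_theorem_of_algebra[of q]
      by (auto simp: constant_degree)
    then obtain p' q' where p': "p = [:- z, 1:] * p'" and q': "q = [:- w, 1:] * q'"
      unfolding poly_eq_0_iff_dvd by (auto elim!: dvdE simp del: mult_pCons_left)
    have nz': "p' \<noteq> 0" "q' \<noteq> 0"
      using nz p' q' by auto
    have deg: "degree p' < degree p" "degree q' < degree q"
      using nz' unfolding p' q' by (simp_all add: degree_mult_eq del: mult_pCons_left)
    have roots: "poly p x = 0" if "poly p' x = 0" for x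
      using that by (simp add: p' del: mult_pCons_left)
    have roots': "poly q x = 0" if "poly q' x = 0" for x
      using that by (simp add: q' del: mult_pCons_left)
    define M1 where "M1 = (\<lambda>\<theta>. (A - mat z) ** M \<theta>)"
    define M2 where "M2 = (\<lambda>\<theta>. M \<theta> ** (B - mat w))"
    have M1: "M1 \<theta> = M1 0" for \<theta>
    proof (rule less.hyps[of p' q])
      show "degree p' + degree q < degree p + degree q" using deg by simp
      show "torus_map M1" using M(1) by (simp add: M1_def torus_map_def)
      show "continuous_on UNIV M1" unfolding M1_def by (intro continuous_intros M(2))
      show "((\<lambda>s. M1 (\<theta> + s *\<^sub>R \<omega>)) has_vector_derivative A ** M1 (\<theta> + t *\<^sub>R \<omega>) - M1 (\<theta> + t *\<^sub>R \<omega>) ** B) (at t)" for \<theta> t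
      proof -
        have "(A - mat z) ** (A ** N - N ** B) = A ** ((A - mat z) ** N) - (A - mat z) ** N ** B" for N
        proof -
          have "(A - mat z) ** A = A ** (A - mat z)"
            by (simp add: matrix_distribs mat_commute)
          then show ?thesis
            by (simp only: matrix_diff_ldistrib[of _ "A ** N"] matrix_mul_assoc)
        qed
        then show ?thesis
          using bounded_linear.has_vector_derivative[OF bounded_bilinear.bounded_linear_right[OF bounded_bilinear_matrix_mult, of "A - mat z"] deriv[of \<theta> t]]
          by (simp add: M1_def)
      qed
      show "peval A p' ** M1 \<theta> = 0" for \<theta>
      proof -
        have "peval A p' ** M1 \<theta> = peval A (p' * [:- z, 1:]) ** M \<theta>"
          by (simp only: M1_def peval_mult peval_linear matrix_mul_assoc)
        then show ?thesis using ann(1) by (simp only: p' mult.commute)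
      qed
      show "M1 \<theta> ** peval B q = 0" for \<theta>
        using ann(2)[of \<theta>] by (simp add: M1_def flip: matrix_mul_assoc)
    qed (use nz nz' nonres roots in auto)
    have M2: "M2 \<theta> = M2 0" for \<theta>
    proof (rule less.hyps[of p q'])
      show "degree p + degree q' < degree p + degree q" using deg by simp
      show "torus_map M2" using M(1) by (simp add: M2_def torus_map_def)
      show "continuous_on UNIV M2" unfolding M2_def by (intro continuous_intros M(2))
      show "((\<lambda>s. M2 (\<theta> + s *\<^sub>R \<omega>)) has_vector_derivative A ** M2 (\<theta> + t *\<^sub>R \<omega>) - M2 (\<theta> + t *\<^sub>R \<omega>) ** B) (at t)" for \<theta> t
      proof -
        have "(A ** N - N ** B) ** (B - mat w) = A ** (N ** (B - mat w)) - N ** (B - mat w) ** B" for N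
        proof -
          have "B ** (B - mat w) = (B - mat w) ** B"
            by (simp add: matrix_distribs mat_commute)
          then show ?thesis
            by (simp only: matrix_diff_rdistrib[of "A ** N"] matrix_mul_assoc[symmetric])
        qed
        then show ?thesis
          using bounded_linear.has_vector_derivative[OF bounded_bilinear.bounded_linear_left[OF bounded_bilinear_matrix_mult, of "B - mat w"] deriv[of \<theta> t]]
          by (simp add: M2_def)
      qed
      show "M2 \<theta> ** peval B q' = 0" for \<theta>
        using ann(2)[of \<theta>] by (simp only: M2_def q' peval_mult peval_linear matrix_mul_assoc)
      show "peval A p ** M2 \<theta> = 0" for \<theta>
        using ann(1)[of \<theta>] by (simp add: M2_def matrix_mul_assoc)
    qed (use nz nz' nonres roots' in auto)
    have split: "A ** M \<theta> - M \<theta> ** B = mat (z - w) ** M \<theta> + (M1 0 - M2 0)" for \<theta>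
      unfolding M1[of \<theta>, symmetric] M2[of \<theta>, symmetric]
      by (simp add: M1_def M2_def matrix_distribs mat_diff mat_commute)
    have "M \<theta> $ i $ j = M 0 $ i $ j" for i j
    proof (rule torus_scalar_ode_constant[OF \<omega>, of "\<lambda>\<theta>. M \<theta> $ i $ j"])
      show "torus_map (\<lambda>\<theta>. M \<theta> $ i $ j)" using M(1) by (simp add: torus_map_def)
      show "continuous_on UNIV (\<lambda>\<theta>. M \<theta> $ i $ j)" by (intro continuous_intros M(2))
      show "((\<lambda>s. M (\<theta> + s *\<^sub>R \<omega>) $ i $ j) has_vector_derivative
          (z - w) * M (\<theta> + t *\<^sub>R \<omega>) $ i $ j + (M1 0 - M2 0) $ i $ j) (at t)" for \<theta> t
        using bounded_linear.has_vector_derivative[OF bounded_linear_entry[of i j] deriv[of \<theta> t]]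
        unfolding split by (simp add: mat_mult_component)
      show "Im (z - w) \<in> frequencies \<omega> \<Longrightarrow> Im (z - w) = 0"
        using nonres zw by blast
    qed
    then show ?thesis by (simp add: vec_eq_iff)
  qed
qed

lemma intertwiner_constant:
  fixes M :: "real ^ 'd \<Rightarrow> complex ^ 'n ^ 'n"
  assumes \<omega>: "rationally_independent \<omega>" and M: "torus_map M" "continuous_on UNIV M"
    and shift: "\<And>\<theta> t. M (\<theta> + t *\<^sub>R \<omega>) = matrix_exp (t *\<^sub>R A) ** M \<theta> ** matrix_exp (- t *\<^sub>R B)"
    and nonres: "\<And>z w. eigenvalue A z \<Longrightarrow> eigenvalue B w \<Longrightarrow> Im (z - w) \<in> frequencies \<omega> \<Longrightarrow> Im (z - w) = 0"
  shows "M \<theta> = M 0"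
proof -
  obtain p where p: "p \<noteq> 0" "peval A p = 0" "\<forall>z. poly p z = 0 \<longleftrightarrow> eigenvalue A z"
    by (rule annihilating_poly_eigenvalues[of A])
  obtain q where q: "q \<noteq> 0" "peval B q = 0" "\<forall>z. poly q z = 0 \<longleftrightarrow> eigenvalue B z"
    by (rule annihilating_poly_eigenvalues[of B])
  show ?thesis
  proof (rule intertwiner_constant_annihilated[OF \<omega> M, of A B p q])
    show "((\<lambda>s. M (\<theta> + s *\<^sub>R \<omega>)) has_vector_derivative A ** M (\<theta> + t *\<^sub>R \<omega>) - M (\<theta> + t *\<^sub>R \<omega>) ** B) (at t)" for \<theta> t
    proof -
      have "((\<lambda>s. matrix_exp (s *\<^sub>R A) ** M \<theta> ** matrix_exp (- s *\<^sub>R B)) has_vector_derivative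
          matrix_exp (t *\<^sub>R A) ** M \<theta> ** - (matrix_exp (- t *\<^sub>R B) ** B)
          + A ** matrix_exp (t *\<^sub>R A) ** M \<theta> ** matrix_exp (- t *\<^sub>R B)) (at t)"
        by (intro matrix_has_vector_derivative_mult matrix_exp_minus_has_vector_derivative
            bounded_linear.has_vector_derivative[OF bounded_bilinear.bounded_linear_left[OF bounded_bilinear_matrix_mult]]
            matrix_exp_has_vector_derivative)
      moreover have "N ** - C = - (N ** C)" for N C :: "complex ^ 'n ^ 'n"
        using matrix_diff_ldistrib[of N 0 C] by simp
      ultimately show ?thesis
        unfolding shift by (simp add: matrix_mul_assoc)
    qed
  qed (use p q nonres in auto)
qed

section \<open>Shifting eigenvalues\<close>

lemma frequencies_zero: "0 \<in> frequencies \<omega>"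
proof -
  have "(0 :: real ^ 'd) \<in> int_lattice" by (simp add: int_lattice_def)
  then show ?thesis unfolding frequencies_def by force
qed

lemma frequencies_add: "x \<in> frequencies \<omega> \<Longrightarrow> y \<in> frequencies \<omega> \<Longrightarrow> x + y \<in> frequencies \<omega>"
  unfolding frequencies_def
  by clarsimp (metis (no_types) distrib_left inner_add_left int_lattice_add)

lemma frequencies_minus: "x \<in> frequencies \<omega> \<Longrightarrow> - x \<in> frequencies \<omega>"
  unfolding frequencies_def
  by clarsimp (metis (no_types) inner_minus_left int_lattice_minus mult_minus_right)

lemma frequencies_diff: "x \<in> frequencies \<omega> \<Longrightarrow> y \<in> frequencies \<omega> \<Longrightarrow> x - y \<in> frequencies \<omega>"
  using frequencies_add[of x \<omega> "- y"] frequencies_minus[of y \<omega>] by simp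

text \<open>For a choice \<open>s\<close> of representatives, \<open>s(y)\<close> and \<open>-s(-y)\<close> both represent the class of \<open>y\<close>, and the
  pair belonging to \<open>-y\<close> consists of their negatives in the other order. Selecting the one of smaller
  modulus is an odd choice. In the case of equal moduli the two numbers agree: if they were opposite,
  the class of \<open>y\<close> would equal its negative, that is \<open>2y \<in> F\<close>, so that \<open>y \<in> F\<close>; and the class \<open>F\<close> is
  represented by 0.\<close>

lemma odd_representatives:
  fixes F :: "real set"
  assumes zero: "0 \<in> F" and diff: "\<And>x y. x \<in> F \<Longrightarrow> y \<in> F \<Longrightarrow> x - y \<in> F"
  obtains r where "\<forall>y. y - r y \<in> F" "\<forall>x y. x - y \<in> F \<longrightarrow> r x = r y"
    "\<forall>y. (2 * y \<in> F \<longrightarrow> y \<in> F) \<longrightarrow> r (- y) = - r y"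
proof -
  have minus: "- x \<in> F" if "x \<in> F" for x
    using diff[OF zero that] by simp
  have add: "x + y \<in> F" if "x \<in> F" "y \<in> F" for x y
    using diff[OF that(1) minus[OF that(2)]] by simp
  define s where "s = (\<lambda>y. SOME x. y - x \<in> F)"
  have s: "y - s y \<in> F" for y
    unfolding s_def by (rule someI[of _ y]) (simp add: zero)
  have s_cong: "s x = s y" if "x - y \<in> F" for x y
  proof -
    have "x - z \<in> F \<longleftrightarrow> y - z \<in> F" for z
      using add[OF that, of "y - z"] diff[OF _ that, of "x - z"] by auto
    then show ?thesis by (simp add: s_def)
  qed
  define r where "r = (\<lambda>y. if y \<in> F then 0 else if \<bar>s y\<bar> \<le> \<bar>s (- y)\<bar> then s y else - s (- y))"
  have "y - r y \<in> F" for y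
    using s[of y] minus[OF s[of "- y"]] by (auto simp: r_def add.commute)
  moreover have "r x = r y" if "x - y \<in> F" for x y
  proof -
    have "x \<in> F \<longleftrightarrow> y \<in> F"
      using add[OF that, of y] diff[OF _ that, of x] by auto
    moreover have "s (- x) = s (- y)"
      using minus[OF that] by (intro s_cong) simp
    ultimately show ?thesis
      using s_cong[OF that] by (simp add: r_def)
  qed
  moreover have "r (- y) = - r y" if "2 * y \<in> F \<longrightarrow> y \<in> F" for y
  proof (cases "y \<in> F")
    case True
    then show ?thesis using minus by (simp add: r_def)
  next
    case False
    then have "- y \<notin> F" using minus by fastforce
    moreover have "s y = - s (- y)" if "\<bar>s y\<bar> = \<bar>s (- y)\<bar>"
    proof (rule ccontr)
      assume "s y \<noteq> - s (- y)"
      with that have "s y = s (- y)" by linarith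
      then have "2 * y \<in> F"
        using diff[OF s[of y] s[of "- y"]] by simp
      with False \<open>2 * y \<in> F \<longrightarrow> y \<in> F\<close> show False by blast
    qed
    ultimately show ?thesis using False by (auto simp: r_def)
  qed
  ultimately show thesis using that by blast
qed

text \<open>On the range of \<open>P\<close> the generator is \<open>B - c\<close>, on the kernel it is \<open>B\<close>.\<close>

lemma matrix_exp_shift:
  fixes B P :: "complex ^ 'n ^ 'n"
  assumes P: "P ** P = P" "B ** P = P ** B"
  shows "matrix_exp (t *\<^sub>R (B - mat c ** P))
      = matrix_exp (t *\<^sub>R B) ** (mat (exp (- (of_real t * c))) ** P + (mat 1 - P))"
proof (rule matrix_exp_unique)
  define S where "S = (\<lambda>a. mat a ** P + (mat 1 - P))"
  show "matrix_exp (0 *\<^sub>R B) ** (mat (exp (- (of_real 0 * c))) ** P + (mat 1 - P)) = mat 1"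
    by (simp add: matrix_exp_0)
  fix t
  let ?E = "matrix_exp (t *\<^sub>R B)" and ?a = "exp (- (of_real t * c))"
  have "P ** ?E = ?E ** P"
    by (rule matrix_exp_commute) (simp add: matrix_scalar_ac scalar_matrix_assoc[symmetric] P)
  then have "P ** (?E ** S ?a) = ?E ** (mat ?a ** P)"
    by (simp only: matrix_mul_assoc) (simp add: S_def matrix_distribs P mat_left_commute[of P] flip: matrix_mul_assoc)
  then have "mat c ** P ** (?E ** S ?a) = ?E ** (mat (c * ?a) ** P)"
    by (simp only: matrix_mul_assoc[symmetric] mat_left_commute[of ?E] mat_mult[symmetric])
  moreover have "mat (- c * ?a) ** P = - (mat (c * ?a) ** P)"
    by (simp add: vec_eq_iff mat_mult_component)
  moreover have "?E ** - (mat (c * ?a) ** P) = - (?E ** (mat (c * ?a) ** P))"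
    using matrix_diff_ldistrib[of ?E 0 "mat (c * ?a) ** P"] by simp
  ultimately have eq: "(B - mat c ** P) ** (?E ** S ?a) = ?E ** (mat (- c * ?a) ** P) + B ** ?E ** S ?a"
    by (simp add: matrix_diff_rdistrib matrix_mul_assoc)
  have "((\<lambda>t. mat (exp (- (of_real t * c))) ** P + (mat 1 - P)) has_vector_derivative mat (- c * ?a) ** P) (at t)"
  proof (rule has_vector_derivative_matrixI)
    fix i j
    have "((\<lambda>t. exp (- (of_real t * c)) * P $ i $ j + (mat 1 - P) $ i $ j) has_vector_derivative (- c * ?a) * P $ i $ j) (at t)"
      by (rule has_vector_derivative_real_field[of "\<lambda>t. exp (- (t * c)) * P $ i $ j + (mat 1 - P) $ i $ j"])
        (auto intro!: derivative_eq_intros)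
    then show "((\<lambda>t. (mat (exp (- (of_real t * c))) ** P + (mat 1 - P)) $ i $ j) has_vector_derivative (mat (- c * ?a) ** P) $ i $ j) (at t)"
      by (simp add: mat_mult_component)
  qed
  from matrix_has_vector_derivative_mult[OF matrix_exp_has_vector_derivative[of B t] this]
  show "((\<lambda>t. matrix_exp (t *\<^sub>R B) ** (mat (exp (- (of_real t * c))) ** P + (mat 1 - P))) has_vector_derivative
      (B - mat c ** P) ** (?E ** (mat ?a ** P + (mat 1 - P)))) (at t)"
    using eq by (simp add: S_def)
qed

lemma lie_algebra_GL_complex: "B \<in> lie_algebra GL_complex"
  by (simp add: lie_algebra_def GL_complex_def invertible_matrix_exp)

lemma int_lattice_inner_Ints: "k \<in> int_lattice \<Longrightarrow> l \<in> int_lattice \<Longrightarrow> k \<bullet> l \<in> \<int>"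
  by (auto simp: inner_vec_def int_lattice_def intro!: Ints_sum Ints_mult)

text \<open>The conjugation is multiplied by \<open>S(e(\<theta>))\<close>, where \<open>S(a)\<close> acts as the scalar \<open>a\<close> on the generalised
  eigenspace of \<open>z\<close> and as the identity on its complement, and \<open>e(\<theta>) = exp(-2\<pi>i\<langle>k,\<theta>\<rangle>)\<close>. Integrality
  of \<open>k\<close> makes \<open>e\<close> a function on the torus.\<close>

lemma eigenvalue_shift:
  fixes B :: "complex ^ 'n ^ 'n" and \<omega> :: "real ^ 'd"
  assumes red: "reducible_to \<omega> GL_complex X B" and ev: "eigenvalue B z" and k: "k \<in> int_lattice"
  obtains B' where "reducible_to \<omega> GL_complex X B'"
    "\<forall>w. eigenvalue B' w \<longrightarrow> w = z - \<i> * of_real (2 * pi * (k \<bullet> \<omega>)) \<or> eigenvalue B w \<and> w \<noteq> z"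
proof -
  obtain P m where P: "P ** P = P" "B ** P = P ** B" "peval B ([:- z, 1:] ^ m) ** P = 0"
    and inj: "\<forall>v. P *v v = 0 \<longrightarrow> B *v v = z *s v \<longrightarrow> v = 0"
    by (rule spectral_projection[OF ev])
  obtain Z where Z: "torus_map Z" "continuous_on UNIV Z" "\<And>\<theta>. invertible (Z \<theta>)"
    and X: "\<And>t \<theta>. X t \<theta> = matrix_inv (Z (\<theta> + t *\<^sub>R \<omega>)) ** matrix_exp (t *\<^sub>R B) ** Z \<theta>"
    using red unfolding reducible_to_def GL_complex_def by auto
  define c where "c = \<i> * of_real (2 * pi * (k \<bullet> \<omega>))"
  define B' where "B' = B - mat c ** P"
  define S where "S = (\<lambda>a. mat a ** P + (mat 1 - P))"
  define e where "e = (\<lambda>\<theta>. exp (- (2 * of_real pi * \<i> * of_real (k \<bullet> \<theta>))))"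
  define Z' where "Z' = (\<lambda>\<theta>. S (e \<theta>) ** Z \<theta>)"
  have S_mult: "S a ** S b = S (a * b)" for a b
    by (simp add: S_def matrix_distribs P mat_mult mat_left_commute[of P] matrix_mul_assoc[symmetric])
      (simp add: matrix_mul_assoc mat_mult P)
  have S_1: "S 1 = mat 1"
    by (simp add: S_def)
  have e_nz: "e \<theta> \<noteq> 0" for \<theta>
    by (simp add: e_def)
  have e_shift: "e (\<theta> + t *\<^sub>R \<omega>) = e \<theta> * exp (- (of_real t * c))" for \<theta> t
    by (simp add: e_def c_def inner_add_right algebra_simps flip: exp_add)
  have Z'_inv: "Z' \<theta> ** (matrix_inv (Z \<theta>) ** S (inverse (e \<theta>))) = mat 1" for \<theta>
  proof -
    have "Z' \<theta> ** (matrix_inv (Z \<theta>) ** S (inverse (e \<theta>))) = S (e \<theta>) ** (Z \<theta> ** matrix_inv (Z \<theta>)) ** S (inverse (e \<theta>))"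
      by (simp only: Z'_def matrix_mul_assoc)
    then show ?thesis
      using Z(3) e_nz by (simp add: invertible_inverse S_mult S_1)
  qed
  have exp_B': "matrix_exp (t *\<^sub>R B') = matrix_exp (t *\<^sub>R B) ** S (exp (- (of_real t * c)))" for t
    unfolding B'_def S_def by (rule matrix_exp_shift[OF P(1,2)])
  have S_commute: "S a ** matrix_exp (t *\<^sub>R B) = matrix_exp (t *\<^sub>R B) ** S a" for a t
  proof (rule matrix_exp_commute)
    have "S a ** B = B ** S a"
      by (simp add: S_def matrix_distribs mat_left_commute[of B] P(2) flip: matrix_mul_assoc)
    then show "S a ** (t *\<^sub>R B) = t *\<^sub>R B ** S a"
      by (simp add: matrix_scalar_ac scalar_matrix_assoc[symmetric])
  qed
  have "reducible_to \<omega> GL_complex X B'"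
    unfolding reducible_to_def
  proof (intro conjI lie_algebra_GL_complex exI[of _ Z'] allI)
    show "torus_map Z'"
      unfolding torus_map_def
    proof safe
      fix \<theta> l :: "real ^ 'd" assume l: "l \<in> int_lattice"
      obtain n :: int where n: "k \<bullet> l = n"
        using int_lattice_inner_Ints[OF k l] by (auto simp: Ints_def)
      have "e (\<theta> + l) = e \<theta> * inverse (exp (of_int (2 * n) * of_real pi * \<i>))"
        unfolding e_def exp_minus[symmetric] exp_add[symmetric]
        by (simp add: inner_add_right n algebra_simps)
      also have "exp (of_int (2 * n) * of_real pi * \<i>) = 1"
        using exp_integer_2pi[of "of_int n"] by (simp add: mult_ac)
      finally show "Z' (\<theta> + l) = Z' \<theta>"
        using torus_mapD[OF Z(1) l] by (simp add: Z'_def)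
    qed
    have "continuous_on UNIV (\<lambda>\<theta>. S (e \<theta>))"
    proof -
      have "S a = (\<chi> i j. a * P $ i $ j + (mat 1 - P) $ i $ j)" for a
        by (simp add: S_def vec_eq_iff mat_mult_component)
      then show ?thesis
        by (simp only:) (intro continuous_intros, simp add: e_def, intro continuous_intros)
    qed
    then show "continuous_on UNIV Z'"
      unfolding Z'_def using Z(2) by (intro continuous_intros)
    show "Z' \<theta> \<in> GL_complex" for \<theta>
      using Z'_inv[of \<theta>] by (auto simp: GL_complex_def invertible_right_inverse)
    show "X t \<theta> = matrix_inv (Z' (\<theta> + t *\<^sub>R \<omega>)) ** matrix_exp (t *\<^sub>R B') ** Z' \<theta>" for t \<theta>
    proof -
      let ?\<phi> = "\<theta> + t *\<^sub>R \<omega>" and ?b = "exp (- (of_real t * c))"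
      have "matrix_inv (Z' ?\<phi>) ** matrix_exp (t *\<^sub>R B') ** Z' \<theta>
          = matrix_inv (Z ?\<phi>) ** (S (inverse (e ?\<phi>)) ** matrix_exp (t *\<^sub>R B)) ** (S ?b ** S (e \<theta>)) ** Z \<theta>"
        unfolding matrix_inv_eqI[OF Z'_inv] exp_B' unfolding Z'_def by (simp only: matrix_mul_assoc)
      also have "\<dots> = matrix_inv (Z ?\<phi>) ** matrix_exp (t *\<^sub>R B) ** (S (inverse (e ?\<phi>)) ** (S ?b ** S (e \<theta>))) ** Z \<theta>"
        by (simp only: S_commute matrix_mul_assoc)
      also have "S (inverse (e ?\<phi>)) ** (S ?b ** S (e \<theta>)) = mat 1"
      proof -
        have "inverse (e ?\<phi>) * (?b * e \<theta>) = 1"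
          using e_nz[of \<theta>] by (simp add: e_shift field_simps)
        then show ?thesis by (simp only: S_mult S_1)
      qed
      finally show ?thesis by (simp add: X)
    qed
  qed
  moreover have "w = z - c \<or> eigenvalue B w \<and> w \<noteq> z" if w: "eigenvalue B' w" for w
  proof -
    obtain v where v: "v \<noteq> 0" "B' *v v = w *s v"
      using w by (auto simp: eigenvalue_def)
    then have Bv: "B *v v = w *s v + c *s (P *v v)"
      by (simp add: B'_def matrix_vector_mult_diff_rdistrib mat_vector_mult algebra_simps flip: matrix_vector_mul_assoc)
    show ?thesis
    proof (cases "P *v v = 0")
      case True
      with v Bv inj show ?thesis by (auto simp: eigenvalue_def)
    next
      case False
      have "B *v (P *v v) = P *v (B *v v)"
        by (simp add: matrix_vector_mul_assoc P(2))
      also have "\<dots> = (w + c) *s (P *v v)"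
        by (simp add: Bv vec.add vec.scale matrix_vector_mul_assoc P(1) vec.scale_left_distrib)
      finally have "peval B ([:- z, 1:] ^ m) *v (P *v v) = poly ([:- z, 1:] ^ m) (w + c) *s (P *v v)"
        by (rule peval_eigenvector)
      then have "poly ([:- z, 1:] ^ m) (w + c) = 0"
        using False by (simp only: matrix_vector_mul_assoc P(3) matrix_vector_mult_0) (metis vec.scale_eq_0_iff)
      then show ?thesis by (simp add: poly_power algebra_simps)
    qed
  qed
  ultimately show thesis using that unfolding c_def by blast
qed

text \<open>Each shift decreases the number of eigenvalues whose imaginary part is not its own
  representative. The old eigenvalues enter the conclusion so that a hypothesis on classes modulo the
  frequencies can be transferred to the new ones.\<close>

lemma reducible_to_representatives:
  fixes B :: "complex ^ 'n ^ 'n"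
  assumes r: "\<forall>y. y - r y \<in> frequencies \<omega>" "\<forall>y. r (r y) = r y"
    and red: "reducible_to \<omega> GL_complex X B"
  shows "\<exists>B'. reducible_to \<omega> GL_complex X B' \<and> (\<forall>w. eigenvalue B' w \<longrightarrow>
    r (Im w) = Im w \<and> (\<exists>z. eigenvalue B z \<and> Im z - Im w \<in> frequencies \<omega>))"
  using red
proof (induction "card {z. eigenvalue B z \<and> r (Im z) \<noteq> Im z}" arbitrary: B rule: less_induct)
  case less
  show ?case
  proof (cases "\<exists>z. eigenvalue B z \<and> r (Im z) \<noteq> Im z")
    case False
    with less.prems frequencies_zero show ?thesis by (metis diff_self)
  next
    case True
    then obtain z where z: "eigenvalue B z" "r (Im z) \<noteq> Im z" by blast
    obtain k where k: "k \<in> int_lattice" "Im z - r (Im z) = 2 * pi * (k \<bullet> \<omega>)"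
      using r(1) unfolding frequencies_def by blast
    obtain B' where B': "reducible_to \<omega> GL_complex X B'"
      and ev: "\<forall>w. eigenvalue B' w \<longrightarrow> w = z - \<i> * of_real (2 * pi * (k \<bullet> \<omega>)) \<or> eigenvalue B w \<and> w \<noteq> z"
      by (rule eigenvalue_shift[OF less.prems z(1) k(1)])
    have new: "Im w = r (Im z) \<or> eigenvalue B w \<and> w \<noteq> z" if "eigenvalue B' w" for w
      using ev[rule_format, OF that] by (auto simp flip: k(2))
    have "eigenvalue B w \<and> w \<noteq> z" if "eigenvalue B' w" "r (Im w) \<noteq> Im w" for w
      using new[OF that(1)] that(2) r(2) by metis
    then have "{w. eigenvalue B' w \<and> r (Im w) \<noteq> Im w} \<subset> {w. eigenvalue B w \<and> r (Im w) \<noteq> Im w}"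
      using z by blast
    then have "card {w. eigenvalue B' w \<and> r (Im w) \<noteq> Im w} < card {w. eigenvalue B w \<and> r (Im w) \<noteq> Im w}"
      by (intro psubset_card_mono finite_subset[OF _ finite_eigenvalues[of B]]) auto
    from less.hyps[OF this B'] obtain B'' where B'': "reducible_to \<omega> GL_complex X B''"
      and ev'': "\<And>w. eigenvalue B'' w \<Longrightarrow>
        r (Im w) = Im w \<and> (\<exists>x. eigenvalue B' x \<and> Im x - Im w \<in> frequencies \<omega>)"
      by blast
    have "\<exists>y. eigenvalue B y \<and> Im y - Im w \<in> frequencies \<omega>" if w: "eigenvalue B'' w" for w
    proof -
      obtain x where x: "eigenvalue B' x" "Im x - Im w \<in> frequencies \<omega>"
        using ev''[OF w] by blast
      from new[OF x(1)] show ?thesis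
      proof
        assume "Im x = r (Im z)"
        then have "Im z - Im w \<in> frequencies \<omega>"
          using frequencies_add[OF r(1)[rule_format, of "Im z"] x(2)] by simp
        with z(1) show ?thesis by blast
      qed (use x in blast)
    qed
    with B'' ev'' show ?thesis by blast
  qed
qed

text \<open>If \<open>Im z\<close> and \<open>-Im w\<close> are in the same class and \<open>r\<close> is an odd choice of representatives fixing
  \<open>Im z\<close> and \<open>Im w\<close>, then \<open>Im z = r(Im z) = r(-Im w) = -Im w\<close>.\<close>

lemma reducible_to_nonresonant:
  fixes B :: "complex ^ 'n ^ 'n"
  assumes red: "reducible_to \<omega> GL_complex X B"
    and adm: "\<And>z. eigenvalue B z \<Longrightarrow> 2 * Im z \<in> frequencies \<omega> \<Longrightarrow> Im z = 0"
  shows "\<exists>B'. reducible_to \<omega> GL_complex X B' \<and> (\<forall>z w. eigenvalue B' z \<longrightarrow> eigenvalue B' w \<longrightarrow>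
    Im z + Im w \<in> frequencies \<omega> \<longrightarrow> Im z + Im w = 0)"
proof -
  obtain r where r: "\<forall>y. y - r y \<in> frequencies \<omega>"
    and cong: "\<forall>x y. x - y \<in> frequencies \<omega> \<longrightarrow> r x = r y"
    and odd: "\<forall>y. (2 * y \<in> frequencies \<omega> \<longrightarrow> y \<in> frequencies \<omega>) \<longrightarrow> r (- y) = - r y"
    by (rule odd_representatives[of "frequencies \<omega>", OF frequencies_zero frequencies_diff])
  have "\<forall>y. r (r y) = r y"
    using r cong by metis
  from reducible_to_representatives[OF r this red] obtain B'
    where B': "reducible_to \<omega> GL_complex X B'"
      and ev: "\<And>w. eigenvalue B' w \<Longrightarrow>
        r (Im w) = Im w \<and> (\<exists>z. eigenvalue B z \<and> Im z - Im w \<in> frequencies \<omega>)"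
    by blast
  have "Im z + Im w = 0"
    if z: "eigenvalue B' z" and w: "eigenvalue B' w" and res: "Im z + Im w \<in> frequencies \<omega>" for z w
  proof -
    obtain x where x: "eigenvalue B x" "Im x - Im w \<in> frequencies \<omega>"
      using ev[OF w] by blast
    have "Im w \<in> frequencies \<omega>" if "2 * Im w \<in> frequencies \<omega>"
    proof -
      have "2 * Im x \<in> frequencies \<omega>"
        using frequencies_add[OF that frequencies_add[OF x(2) x(2)]] by simp
      then have "Im x = 0" by (rule adm[OF x(1)])
      then show ?thesis using frequencies_minus[OF x(2)] by simp
    qed
    then have "r (- Im w) = - Im w"
      using odd ev[OF w] by simp
    moreover have "r (Im z) = r (- Im w)"
      using res by (intro cong[rule_format]) simp
    ultimately show ?thesis
      using ev[OF z] by simp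
  qed
  with B' show ?thesis by blast
qed

section \<open>Real matrices\<close>

definition cnj_matrix :: "complex ^ 'n ^ 'n \<Rightarrow> complex ^ 'n ^ 'n" where
  "cnj_matrix M = (\<chi> i j. cnj (M $ i $ j))"

lemma cnj_matrix_mult: "cnj_matrix (A ** B) = cnj_matrix A ** cnj_matrix B"
  by (simp add: cnj_matrix_def matrix_matrix_mult_def vec_eq_iff)

lemma cnj_matrix_mat: "cnj_matrix (mat a) = mat (cnj a)"
  by (simp add: cnj_matrix_def mat_def vec_eq_iff)

lemma cnj_matrix_diff: "cnj_matrix (A - B) = cnj_matrix A - cnj_matrix B"
  by (simp add: cnj_matrix_def vec_eq_iff)

lemma cnj_matrix_cnj_matrix: "cnj_matrix (cnj_matrix A) = A"
  by (simp add: cnj_matrix_def vec_eq_iff)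

lemma bounded_linear_cnj_matrix: "bounded_linear cnj_matrix"
  by (auto intro!: linearI simp: linear_conv_bounded_linear[symmetric] cnj_matrix_def vec_eq_iff)

lemma bounded_linear_transpose: "bounded_linear (transpose :: complex ^ 'n ^ 'n \<Rightarrow> _)"
  by (auto intro!: linearI simp: linear_conv_bounded_linear[symmetric] transpose_def vec_eq_iff)

lemma det_cnj_matrix: "det (cnj_matrix A) = cnj (det A)"
  by (simp add: det_def cnj_matrix_def)

lemma cnj_matrix_exp: "cnj_matrix (matrix_exp (t *\<^sub>R B)) = matrix_exp (t *\<^sub>R cnj_matrix B)"
proof (rule matrix_exp_unique[symmetric])
  show "((\<lambda>t. cnj_matrix (matrix_exp (t *\<^sub>R B))) has_vector_derivative
      cnj_matrix B ** cnj_matrix (matrix_exp (t *\<^sub>R B))) (at t)" for t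
    using bounded_linear.has_vector_derivative[OF bounded_linear_cnj_matrix matrix_exp_has_vector_derivative[of B t]]
    by (simp add: cnj_matrix_mult)
  show "cnj_matrix (matrix_exp (0 *\<^sub>R B)) = mat 1"
    by (simp add: matrix_exp_0 cnj_matrix_mat)
qed

lemma transpose_matrix_exp:
  fixes B :: "complex ^ 'n ^ 'n"
  shows "transpose (matrix_exp (- t *\<^sub>R B)) = matrix_exp (t *\<^sub>R (- transpose B))"
proof (rule matrix_exp_unique[symmetric])
  have "transpose (- (M ** B)) = - transpose B ** transpose M" for M :: "complex ^ 'n ^ 'n"
    by (simp add: matrix_minus_left flip: matrix_transpose_mul) (simp add: transpose_def vec_eq_iff)
  then show "((\<lambda>t. transpose (matrix_exp (- t *\<^sub>R B))) has_vector_derivative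
      - transpose B ** transpose (matrix_exp (- t *\<^sub>R B))) (at t)" for t
    using bounded_linear.has_vector_derivative[OF bounded_linear_transpose matrix_exp_minus_has_vector_derivative[of B t]]
    by simp
  show "transpose (matrix_exp (- 0 *\<^sub>R B)) = mat 1"
    by (simp add: matrix_exp_0 transpose_mat)
qed

lemma invertible_cnj_matrix: "invertible (A :: complex ^ 'n ^ 'n) \<Longrightarrow> invertible (cnj_matrix A)"
  unfolding invertible_def by (metis cnj_matrix_mat cnj_matrix_mult complex_cnj_one)

lemma eigenvalue_cnj_matrix: "eigenvalue (cnj_matrix A) z \<longleftrightarrow> eigenvalue A (cnj z)"
proof -
  have "cnj_matrix (A - mat (cnj z)) = cnj_matrix A - mat z"
    by (simp add: cnj_matrix_diff cnj_matrix_mat)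
  then show ?thesis
    unfolding eigenvalue_iff_not_invertible
    using invertible_cnj_matrix[of "A - mat (cnj z)"] invertible_cnj_matrix[of "cnj_matrix A - mat z"]
    by (metis cnj_matrix_cnj_matrix)
qed

lemma eigenvalue_minus_transpose:
  fixes A :: "complex ^ 'n ^ 'n"
  shows "eigenvalue (- transpose A) z \<longleftrightarrow> eigenvalue A (- z)"
proof -
  have "transpose (A - mat (- z)) = mat z + transpose A"
    by (simp add: transpose_def mat_def vec_eq_iff)
  then have "- transpose A - mat z = - transpose (A - mat (- z))"
    by simp
  moreover have "det (- M) \<noteq> 0 \<longleftrightarrow> det M \<noteq> 0" for M :: "complex ^ 'n ^ 'n"
  proof -
    have "- M = mat (-1) ** M"
      by (simp add: vec_eq_iff mat_mult_component)
    moreover have "invertible (mat (-1) :: complex ^ 'n ^ 'n)"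
      by (auto simp: invertible_def mat_mult intro!: exI[of _ "mat (-1)"])
    ultimately show ?thesis
      by (simp add: det_mul invertible_det_nz)
  qed
  ultimately show ?thesis
    by (simp add: eigenvalue_iff_not_invertible invertible_det_nz det_transpose)
qed

lemma complex_matrix_mult: "complex_matrix (A ** B) = complex_matrix A ** complex_matrix B"
  by (simp add: complex_matrix_def matrix_matrix_mult_def vec_eq_iff)

lemma complex_matrix_transpose: "complex_matrix (transpose A) = transpose (complex_matrix A)"
  by (simp add: complex_matrix_def transpose_def vec_eq_iff)

lemma complex_matrix_mat: "complex_matrix (mat a) = mat (of_real a)"
  by (simp add: complex_matrix_def mat_def vec_eq_iff)

lemma complex_matrix_eq_iff: "complex_matrix A = complex_matrix B \<longleftrightarrow> A = B"
  by (simp add: complex_matrix_def vec_eq_iff)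

lemma det_complex_matrix: "det (complex_matrix A) = of_real (det A)"
  by (simp add: det_def complex_matrix_def)

lemma cnj_complex_matrix: "cnj_matrix (complex_matrix A) = complex_matrix A"
  by (simp add: cnj_matrix_def complex_matrix_def vec_eq_iff)

text \<open>Membership in a group of real matrices splits into being real and a condition that makes sense
  for complex matrices. The orthogonality condition below contains the factor \<open>mat 1\<close> to be an
  instance of the preservation of a bilinear form.\<close>

lemma image_complex_matrix_iff:
  assumes "\<And>A. P A \<longleftrightarrow> Q (complex_matrix A)"
  shows "M \<in> complex_matrix ` {A. P A} \<longleftrightarrow> cnj_matrix M = M \<and> Q M"
proof -
  have "M = complex_matrix (\<chi> i j. Re (M $ i $ j))" if "cnj_matrix M = M"
    using that by (auto simp: cnj_matrix_def complex_matrix_def vec_eq_iff complex_eq_iff)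
  then show ?thesis
    using assms by (auto simp: cnj_complex_matrix)
qed

lemma GL_real_iff: "M \<in> GL_real \<longleftrightarrow> cnj_matrix M = M \<and> det M \<noteq> 0"
  unfolding GL_real_def by (rule image_complex_matrix_iff) (simp add: invertible_det_nz det_complex_matrix)

lemma SL_real_iff: "M \<in> SL_real \<longleftrightarrow> cnj_matrix M = M \<and> det M = 1"
  unfolding SL_real_def by (rule image_complex_matrix_iff) (simp add: det_complex_matrix)

lemma O_real_iff: "M \<in> O_real \<longleftrightarrow> cnj_matrix M = M \<and> transpose M ** mat 1 ** M = mat 1"
  unfolding O_real_def
proof (rule image_complex_matrix_iff)
  show "orthogonal_matrix A \<longleftrightarrow> transpose (complex_matrix A) ** mat 1 ** complex_matrix A = mat 1" for A :: "real ^ 'a ^ 'a"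
    using complex_matrix_eq_iff[of "transpose A ** A" "mat 1"]
    by (simp add: orthogonal_matrix complex_matrix_mult complex_matrix_transpose complex_matrix_mat)
qed

lemma Sp_real_iff: "M \<in> Sp_real \<longleftrightarrow> cnj_matrix M = M \<and>
    transpose M ** complex_matrix symplectic_J ** M = complex_matrix symplectic_J"
  unfolding Sp_real_def
  by (rule image_complex_matrix_iff)
    (simp flip: complex_matrix_mult complex_matrix_transpose add: complex_matrix_eq_iff)

section \<open>Bilinear forms, determinants and inverses\<close>

lemma preserves_form_mult:
  fixes M N K :: "complex ^ 'n ^ 'n"
  assumes "transpose M ** K ** M = K" "transpose N ** K ** N = K"
  shows "transpose (M ** N) ** K ** (M ** N) = K"
proof -
  have "transpose (M ** N) ** K ** (M ** N) = transpose N ** (transpose M ** K ** M) ** N"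
    by (simp only: matrix_transpose_mul matrix_mul_assoc)
  then show ?thesis by (simp only: assms)
qed

lemma matrix_inv_mat_1: "matrix_inv (mat 1 :: 'a::field ^ 'n ^ 'n) = mat 1"
  by (rule matrix_inv_eqI) simp

lemma continuous_on_det:
  fixes f :: "'a::topological_space \<Rightarrow> complex ^ 'n ^ 'n"
  assumes "continuous_on S f"
  shows "continuous_on S (\<lambda>x. det (f x))"
  unfolding det_def by (intro continuous_intros assms)

text \<open>Cramer's rule expresses the entries of the inverse as quotients of determinants.\<close>

lemma continuous_on_matrix_inv:
  fixes f :: "'a::topological_space \<Rightarrow> complex ^ 'n ^ 'n"
  assumes f: "continuous_on S f" and inv: "\<And>x. x \<in> S \<Longrightarrow> invertible (f x)"
  shows "continuous_on S (\<lambda>x. matrix_inv (f x))"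
proof -
  define e :: "'n \<Rightarrow> complex ^ 'n" where "e = (\<lambda>k. column k (mat 1))"
  define C where "C = (\<lambda>i k x. \<chi> a b. if b = i then e k $ a else f x $ a $ b)"
  have C: "continuous_on S (C i k)" for i k
    unfolding C_def
  proof (intro continuous_on_vec_lambda)
    show "continuous_on S (\<lambda>x. if b = i then e k $ a else f x $ a $ b)" for a b
      by (cases "b = i") (auto intro!: continuous_intros f)
  qed
  have det: "det (f x) \<noteq> 0" if "x \<in> S" for x
    using inv[OF that] by (simp add: invertible_det_nz)
  have entry: "matrix_inv (f x) $ i $ k = det (C i k x) / det (f x)" if "x \<in> S" for x i k
  proof -
    have "f x *v column k (matrix_inv (f x)) = column k (f x ** matrix_inv (f x))"
      by (simp add: column_def matrix_vector_mult_def matrix_matrix_mult_def vec_eq_iff)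
    also have "\<dots> = e k"
      by (simp add: invertible_inverse inv[OF that] e_def)
    finally have "column k (matrix_inv (f x)) $ i = det (C i k x) / det (f x)"
      using cramer[OF det[OF that], of "column k (matrix_inv (f x))"] by (simp add: C_def)
    then show ?thesis by (simp add: column_def)
  qed
  have "continuous_on S (\<lambda>x. \<chi> i k. det (C i k x) / det (f x))"
    by (intro continuous_intros continuous_on_det C f ballI det)
  then show ?thesis
    by (rule continuous_on_eq) (simp add: vec_eq_iff entry)
qed

section \<open>The normalised conjugation\<close>

text \<open>The condition \<open>Im z + Im w\<close> covers both applications: conjugation turns an eigenvalue \<open>z\<close> into
  one with imaginary part \<open>-Im z\<close>, and so does passing to minus the transpose.\<close>

locale normalised_conjugation =
  fixes \<omega> :: "real ^ 'd" and X :: "real \<Rightarrow> real ^ 'd \<Rightarrow> complex ^ 'n ^ 'n"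
    and R :: "real ^ 'd \<Rightarrow> complex ^ 'n ^ 'n" and B :: "complex ^ 'n ^ 'n"
  assumes \<omega>: "rationally_independent \<omega>"
    and R: "torus_map R" "continuous_on UNIV R" "invertible (R \<theta>)"
    and R_0: "R 0 = mat 1"
    and conj: "R (\<theta> + t *\<^sub>R \<omega>) ** X t \<theta> = matrix_exp (t *\<^sub>R B) ** R \<theta>"
    and nonres: "eigenvalue B z \<Longrightarrow> eigenvalue B w \<Longrightarrow> Im z + Im w \<in> frequencies \<omega> \<Longrightarrow> Im z + Im w = 0"
begin

lemma R_inv_shift:
  "matrix_inv (R (\<theta> + t *\<^sub>R \<omega>)) = X t \<theta> ** matrix_inv (R \<theta>) ** matrix_exp (- t *\<^sub>R B)"
proof (rule matrix_inv_eqI)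
  have "R (\<theta> + t *\<^sub>R \<omega>) ** (X t \<theta> ** matrix_inv (R \<theta>) ** matrix_exp (- t *\<^sub>R B))
      = matrix_exp (t *\<^sub>R B) ** (R \<theta> ** matrix_inv (R \<theta>)) ** matrix_exp (- t *\<^sub>R B)"
    by (simp only: matrix_mul_assoc conj)
  then show "R (\<theta> + t *\<^sub>R \<omega>) ** (X t \<theta> ** matrix_inv (R \<theta>) ** matrix_exp (- t *\<^sub>R B)) = mat 1"
    by (simp only: invertible_inverse R(3) matrix_mul_rid matrix_exp_mult_minus)
qed

lemma R_inv: "torus_map (\<lambda>\<theta>. matrix_inv (R \<theta>))" "continuous_on UNIV (\<lambda>\<theta>. matrix_inv (R \<theta>))"
  using R by (auto simp: torus_map_def intro!: continuous_on_matrix_inv)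

lemma matrix_exp_eq: "matrix_exp (t *\<^sub>R B) = R (t *\<^sub>R \<omega>) ** X t 0"
  using conj[of 0 t] by (simp add: R_0)

text \<open>The intertwiner \<open>R\<^sup>* R\<^sup>-\<^sup>1\<close> of \<open>B\<^sup>*\<close> and \<open>B\<close> is constant and equals 1 at 0.\<close>

lemma R_real:
  assumes X: "\<And>t \<theta>. cnj_matrix (X t \<theta>) = X t \<theta>"
  shows "cnj_matrix (R \<theta>) = R \<theta>"
proof -
  define W where "W = (\<lambda>\<theta>. cnj_matrix (R \<theta>) ** matrix_inv (R \<theta>))"
  have "W \<theta> = W 0"
  proof (rule intertwiner_constant[OF \<omega>, of W "cnj_matrix B" B])
    show "torus_map W"
      using R(1) R_inv(1) by (simp add: W_def torus_map_def)
    show "continuous_on UNIV W"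
      unfolding W_def
      by (intro continuous_intros R_inv bounded_linear.continuous_on[OF bounded_linear_cnj_matrix] R)
    show "W (\<theta> + t *\<^sub>R \<omega>) = matrix_exp (t *\<^sub>R cnj_matrix B) ** W \<theta> ** matrix_exp (- t *\<^sub>R B)" for \<theta> t
    proof -
      have "cnj_matrix (R (\<theta> + t *\<^sub>R \<omega>)) ** X t \<theta> = matrix_exp (t *\<^sub>R cnj_matrix B) ** cnj_matrix (R \<theta>)"
        using arg_cong[OF conj[of \<theta> t], of cnj_matrix] by (simp add: cnj_matrix_mult X cnj_matrix_exp)
      then show ?thesis
        unfolding W_def R_inv_shift by (simp add: matrix_mul_assoc)
    qed
    show "Im (z - w) = 0" if "eigenvalue (cnj_matrix B) z" "eigenvalue B w" "Im (z - w) \<in> frequencies \<omega>" for z w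
      using nonres[of "cnj z" w] that frequencies_minus[of "Im (z - w)" \<omega>]
      by (simp add: eigenvalue_cnj_matrix)
  qed
  then have "W \<theta> = mat 1"
    by (simp add: W_def R_0 cnj_matrix_mat matrix_inv_mat_1)
  then have "cnj_matrix (R \<theta>) ** (matrix_inv (R \<theta>) ** R \<theta>) = R \<theta>"
    by (simp add: W_def matrix_mul_assoc)
  then show ?thesis
    by (simp add: invertible_inverse R(3))
qed

text \<open>The form \<open>K\<close> transported by \<open>R\<close> is an intertwiner of \<open>-B\<^sup>T\<close> and \<open>B\<close>; it is constant and equals \<open>K\<close>
  at 0.\<close>

lemma R_preserves_form:
  assumes X: "\<And>t \<theta>. transpose (X t \<theta>) ** K ** X t \<theta> = K"
  shows "transpose (R \<theta>) ** K ** R \<theta> = K"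
proof -
  define Q where "Q = (\<lambda>\<theta>. transpose (matrix_inv (R \<theta>)) ** K ** matrix_inv (R \<theta>))"
  have "Q \<theta> = Q 0"
  proof (rule intertwiner_constant[OF \<omega>, of Q "- transpose B" B])
    show "torus_map Q"
      using R_inv(1) by (simp add: Q_def torus_map_def)
    show "continuous_on UNIV Q"
      unfolding Q_def
      by (intro continuous_intros R_inv bounded_linear.continuous_on[OF bounded_linear_transpose])
    show "Q (\<theta> + t *\<^sub>R \<omega>) = matrix_exp (t *\<^sub>R (- transpose B)) ** Q \<theta> ** matrix_exp (- t *\<^sub>R B)" for \<theta> t
    proof -
      have "Q (\<theta> + t *\<^sub>R \<omega>) = transpose (matrix_exp (- t *\<^sub>R B)) ** transpose (matrix_inv (R \<theta>))
          ** (transpose (X t \<theta>) ** K ** X t \<theta>) ** matrix_inv (R \<theta>) ** matrix_exp (- t *\<^sub>R B)"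
        unfolding Q_def R_inv_shift by (simp only: matrix_transpose_mul matrix_mul_assoc)
      then show ?thesis
        unfolding X by (simp only: Q_def transpose_matrix_exp matrix_mul_assoc)
    qed
    show "Im (z - w) = 0" if "eigenvalue (- transpose B) z" "eigenvalue B w" "Im (z - w) \<in> frequencies \<omega>" for z w
      using nonres[of "- z" w] that frequencies_minus[of "Im (z - w)" \<omega>]
      by (simp add: eigenvalue_minus_transpose)
  qed
  then have "Q \<theta> = K"
    by (simp add: Q_def R_0 matrix_inv_mat_1 transpose_mat)
  moreover have "transpose (matrix_inv (R \<theta>) ** R \<theta>) ** K ** (matrix_inv (R \<theta>) ** R \<theta>)
      = transpose (R \<theta>) ** Q \<theta> ** R \<theta>"
    by (simp only: Q_def matrix_transpose_mul matrix_mul_assoc)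
  ultimately show ?thesis
    by (simp add: invertible_inverse R(3) transpose_mat)
qed

text \<open>On the orbit of 0 the determinant of \<open>R\<close> is the homomorphism \<open>g(t) = det exp(tB)\<close>. It is bounded,
  so it has modulus 1; it is real, so \<open>g(t) = g(t/2)\<^sup>2 = 1\<close>.\<close>

lemma det_R:
  assumes X: "\<And>t \<theta>. cnj_matrix (X t \<theta>) = X t \<theta>" "\<And>t \<theta>. det (X t \<theta>) = 1"
  shows "det (R \<theta>) = 1"
proof -
  have torus: "torus_map (\<lambda>\<theta>. det (R \<theta>))" "continuous_on UNIV (\<lambda>\<theta>. det (R \<theta>))"
    using R by (auto simp: torus_map_def intro!: continuous_on_det)
  define g where "g = (\<lambda>t. det (matrix_exp (t *\<^sub>R B)))"
  have g: "det (R (t *\<^sub>R \<omega>)) = g t" for t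
    by (simp add: g_def matrix_exp_eq det_mul X(2))
  have g_add: "g (s + t) = g s * g t" for s t
    by (simp add: g_def matrix_exp_add det_mul)
  have g_0: "g 0 = 1"
    by (simp add: g_def matrix_exp_0)
  obtain K where K: "\<forall>\<theta>. norm (det (R \<theta>)) \<le> K"
    using torus_map_bounded[OF torus] by blast
  have le: "norm (g t) \<le> 1" for t
  proof (rule ccontr)
    assume "\<not> norm (g t) \<le> 1"
    then obtain n where n: "K < norm (g t) ^ n"
      using real_arch_pow[of "norm (g t)" K] by auto
    have "g (real n * t) = g t ^ n"
      by (induction n) (simp_all add: g_0 g_add distrib_right)
    with n K g[of "real n * t"] show False
      by (metis norm_power not_less)
  qed
  have norm_g: "norm (g t) = 1" for t
  proof -
    have "norm (g t) * norm (g (- t)) = 1"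
      using g_add[of t "- t"] g_0 by (simp flip: norm_mult)
    moreover have "norm (g t) * norm (g (- t)) \<le> norm (g t)"
      using mult_left_le[OF le[of "- t"], of "norm (g t)"] by simp
    ultimately show ?thesis using le[of t] by linarith
  qed
  have "g t = 1" for t
  proof -
    have "cnj (g (t / 2)) = g (t / 2)"
      by (simp flip: g det_cnj_matrix add: R_real X)
    then have "g (t / 2) * g (t / 2) = of_real (norm (g (t / 2)) ^ 2)"
      by (metis complex_norm_square mult.commute of_real_power power2_eq_square)
    then show ?thesis
      using g_add[of "t / 2" "t / 2"] by (simp add: norm_g)
  qed
  then show ?thesis
    using torus_map_eqI[OF \<omega> torus(1) _ torus(2), of "\<lambda>_. 1"] by (simp add: g torus_map_def)
qed

text \<open>It suffices to place \<open>R\<close> in the group: the one-parameter group \<open>exp(tB) = R(t\<omega>) X\<^sup>t(0)\<close> follows.\<close>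

lemma reducible_in_subgroup:
  assumes X: "\<And>t \<theta>. X t \<theta> \<in> G" and R_G: "\<And>\<theta>. R \<theta> \<in> G"
    and mult: "\<And>M N. M \<in> G \<Longrightarrow> N \<in> G \<Longrightarrow> M ** N \<in> G"
  shows "reducible_to \<omega> G X B"
  unfolding reducible_to_def
proof (intro conjI exI[of _ R] allI)
  show "B \<in> lie_algebra G"
    using assms by (simp add: lie_algebra_def matrix_exp_eq)
  show "X t \<theta> = matrix_inv (R (\<theta> + t *\<^sub>R \<omega>)) ** matrix_exp (t *\<^sub>R B) ** R \<theta>" for t \<theta>
  proof -
    have "matrix_inv (R (\<theta> + t *\<^sub>R \<omega>)) ** (R (\<theta> + t *\<^sub>R \<omega>) ** X t \<theta>) = X t \<theta>"
      by (simp add: matrix_mul_assoc invertible_inverse R(3))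
    then show ?thesis by (simp add: conj matrix_mul_assoc)
  qed
qed (use R R_G in auto)

end

text \<open>The constant factor \<open>Z(0)\<^sup>-\<^sup>1\<close> normalises the conjugation and replaces \<open>B\<close> by a similar matrix.\<close>

lemma normalised_conjugation_exists:
  fixes \<omega> :: "real ^ 'd" and B :: "complex ^ 'n ^ 'n"
  assumes \<omega>: "rationally_independent \<omega>"
    and red: "reducible_to \<omega> GL_complex X B"
    and nonres: "\<forall>z w. eigenvalue B z \<longrightarrow> eigenvalue B w \<longrightarrow> Im z + Im w \<in> frequencies \<omega> \<longrightarrow> Im z + Im w = 0"
  obtains R B' where "normalised_conjugation \<omega> X R B'"
proof -
  obtain Z where Z: "torus_map Z" "continuous_on UNIV Z" "\<And>\<theta>. invertible (Z \<theta>)"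
    and X: "\<And>t \<theta>. X t \<theta> = matrix_inv (Z (\<theta> + t *\<^sub>R \<omega>)) ** matrix_exp (t *\<^sub>R B) ** Z \<theta>"
    using red unfolding reducible_to_def GL_complex_def by auto
  let ?T = "matrix_inv (Z 0)"
  have T: "Z 0 ** ?T = mat 1" "?T ** Z 0 = mat 1" "invertible ?T"
    using Z(3) by (simp_all add: invertible_inverse)
  have "normalised_conjugation \<omega> X (\<lambda>\<theta>. ?T ** Z \<theta>) (?T ** B ** Z 0)"
  proof
    show "torus_map (\<lambda>\<theta>. ?T ** Z \<theta>)" using Z(1) by (simp add: torus_map_def)
    show "continuous_on UNIV (\<lambda>\<theta>. ?T ** Z \<theta>)" by (intro continuous_intros Z)
    show "invertible (?T ** Z \<theta>)" for \<theta> by (intro invertible_mult T Z)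
    show "?T ** Z 0 = mat 1" by (rule T)
    show "?T ** Z (\<theta> + t *\<^sub>R \<omega>) ** X t \<theta> = matrix_exp (t *\<^sub>R (?T ** B ** Z 0)) ** (?T ** Z \<theta>)" for \<theta> t
    proof -
      have "?T ** Z (\<theta> + t *\<^sub>R \<omega>) ** X t \<theta>
          = ?T ** (Z (\<theta> + t *\<^sub>R \<omega>) ** matrix_inv (Z (\<theta> + t *\<^sub>R \<omega>))) ** matrix_exp (t *\<^sub>R B) ** Z \<theta>"
        by (simp only: X matrix_mul_assoc)
      also have "\<dots> = ?T ** matrix_exp (t *\<^sub>R B) ** (Z 0 ** ?T) ** Z \<theta>"
        by (simp add: invertible_inverse Z(3) T)
      finally show ?thesis
        by (simp only: matrix_exp_similar[OF T(1)] matrix_mul_assoc)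
    qed
    have "eigenvalue B z" if ev: "eigenvalue (?T ** B ** Z 0) z" for z
    proof -
      obtain v where v: "v \<noteq> 0" "(?T ** B ** Z 0) *v v = z *s v"
        using ev by (auto simp: eigenvalue_def)
      have "B *v (Z 0 *v v) = (Z 0 ** ?T) *v (B *v (Z 0 *v v))"
        by (simp add: T)
      also have "\<dots> = Z 0 *v ((?T ** B ** Z 0) *v v)"
        by (simp only: matrix_vector_mul_assoc matrix_mul_assoc)
      finally have "B *v (Z 0 *v v) = z *s (Z 0 *v v)"
        by (simp add: v(2) vec.scale)
      moreover have "Z 0 *v v \<noteq> 0"
      proof
        assume "Z 0 *v v = 0"
        then have "(?T ** Z 0) *v v = 0"
          by (simp flip: matrix_vector_mul_assoc)
        with v(1) show False by (simp add: T)
      qed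
      ultimately show ?thesis by (auto simp: eigenvalue_def)
    qed
    then show "Im z + Im w = 0"
      if "eigenvalue (?T ** B ** Z 0) z" "eigenvalue (?T ** B ** Z 0) w" "Im z + Im w \<in> frequencies \<omega>" for z w
      using nonres that by blast
  qed (rule \<omega>)
  then show thesis by (rule that)
qed

theorem proposition1:
  fixes \<omega> :: "real ^ 'd"
    and G :: "(complex ^ 'n::{finite,linorder} ^ 'n::{finite,linorder}) set"
    and X :: "real \<Rightarrow> real ^ 'd \<Rightarrow> complex ^ 'n::{finite,linorder} ^ 'n::{finite,linorder}"
    and B :: "complex ^ 'n::{finite,linorder} ^ 'n::{finite,linorder}"
  assumes "rationally_independent \<omega>"
    and "G = GL_real \<or> G = SL_real \<or> (even CARD('n) \<and> G = Sp_real) \<or> G = O_real"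
    and "continuous_cocycle \<omega> G X"
    and "reducible_to \<omega> GL_complex X B"
    and "\<And>z. eigenvalue B z \<Longrightarrow> Im z \<notin> {pi * (k \<bullet> \<omega>) | k. k \<in> int_lattice} - {0}"
  shows "reducible \<omega> G X"
proof -
  have "Im z = 0" if "eigenvalue B z" "2 * Im z \<in> frequencies \<omega>" for z
    using assms(5)[OF that(1)] that(2) by (auto simp: frequencies_def)
  from reducible_to_nonresonant[OF assms(4) this] obtain B'
    where "reducible_to \<omega> GL_complex X B'"
      and "\<forall>z w. eigenvalue B' z \<longrightarrow> eigenvalue B' w \<longrightarrow> Im z + Im w \<in> frequencies \<omega> \<longrightarrow> Im z + Im w = 0"
    by blast
  from normalised_conjugation_exists[OF assms(1) this] obtain R B''
    where conj: "normalised_conjugation \<omega> X R B''" .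
  interpret normalised_conjugation \<omega> X R B'' by (rule conj)
  have X: "X t \<theta> \<in> G" for t \<theta>
    using assms(3) by (simp add: continuous_cocycle_def)
  have X_real: "cnj_matrix (X t \<theta>) = X t \<theta>" for t \<theta>
    using X[of t \<theta>] assms(2) by (auto simp: GL_real_iff SL_real_iff Sp_real_iff O_real_iff)
  note R_real = R_real[OF X_real]
  have "(\<forall>\<theta>. R \<theta> \<in> G) \<and> (\<forall>M\<in>G. \<forall>N\<in>G. M ** N \<in> G)"
    using assms(2)
  proof (elim disjE conjE)
    assume G: "G = GL_real"
    show ?thesis
      using R(3) by (auto simp: G GL_real_iff R_real cnj_matrix_mult det_mul invertible_det_nz)
  next
    assume G: "G = SL_real"
    have "det (R \<theta>) = 1" for \<theta>
      using X by (intro det_R X_real) (simp add: G SL_real_iff)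
    then show ?thesis
      by (auto simp: G SL_real_iff R_real cnj_matrix_mult det_mul)
  next
    assume G: "G = Sp_real"
    have "transpose (R \<theta>) ** complex_matrix symplectic_J ** R \<theta> = complex_matrix symplectic_J" for \<theta>
      using X by (intro R_preserves_form) (simp add: G Sp_real_iff)
    then show ?thesis
      unfolding G Ball_def Sp_real_iff by (auto simp: R_real cnj_matrix_mult preserves_form_mult)
  next
    assume G: "G = O_real"
    have "transpose (R \<theta>) ** mat 1 ** R \<theta> = mat 1" for \<theta>
      using X by (intro R_preserves_form) (simp add: G O_real_iff)
    then show ?thesis
      unfolding G Ball_def O_real_iff using preserves_form_mult[of _ "mat 1"] by (auto simp: R_real cnj_matrix_mult)
  qed
  then have "reducible_to \<omega> G X B''"
    using X by (intro reducible_in_subgroup) auto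
  then show ?thesis
    by (auto simp: reducible_def)
qed

end
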